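(* Let $p$ be a prime and let $G$ be a $p$-group of maximal class of order $p^m$ (so $m\ge 4$ and $G$ has nilpotency class $m-1$) with positive degree of commutativity. (1) If $G$ possesses an abelian maximal subgroup, then $$B_G(t)=\frac{1}{1-pt}\left(1+ \frac{(p^{m-2}-1)t}{1-p^{m-1}t}+ \frac{(p^{2}-p)t}{1-p^{2}t} \right).$$ (2) If $[P_1, P_3]= 1$ and $G$ possesses no abelian maximal subgroup, then $$B_G(t)=\frac{1}{1-pt}\left(1+ \frac{(p^{m-4}-1)t(1-p^{m-4}t)}{(1-p^{m-2}t)(1-p^{m-3}t)}+\frac{(p^{m-3}-p^{m-5})t}{1-p^{m-2}t}+\frac{(p^2-p)t}{1-p^2t}\right).$$
   Context: For a finite group $G$ and $n\ge 0$, let $G^{(n)}=\{(x_1,\dots,x_n)\in G^n : [x_i,x_j]=1\text{ for all }1\le i,j\le n\}$, on which $G$ acts by simultaneous conjugation $g\cdot(x_1,\dots,x_n)=(gx_1g^{-1},\dots,gx_ng^{-1})$. Let $\beta_{G,n}$ denote the number of $G$-orbits in $G^{(n)}$, with $\beta_{G,0}=1$, and $B_G(t)=\sum_{n\ge 0}\beta_{G,n}t^n$ (a formal power series, which is a rational function of $t$). A group of order $p^m$ with $m\ge 4$ is of maximal class if it has nilpotency class $m-1$. Let $G$ be such a group, and let $\gamma_i(G)$ be the $i$th term of its lower central series ($\gamma_1(G)=G$). For $2\le i\le m-2$, the 2-step centralizer $K_i$ is the centralizer in $G$ of $\gamma_i(G)/\gamma_{i+2}(G)$, i.e. $K_i=\{g\in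 G : [g,x]\in\gamma_{i+2}(G)\text{ for all }x\in\gamma_i(G)\}$. Define $P_0=G$, $P_1=K_2$, $P_i=\gamma_i(G)$ for $2\le i\le m$, and $P_i=1$ for $i\ge m$. The degree of commutativity $l=l(G)$ is the maximum integer such that $[P_i,P_j]\le P_{i+j+l}$ for all $i,j\ge 1$ if $P_1$ is not abelian, and $l=m-3$ if $P_1$ is abelian. *)

theory Defs
  imports
    Complex_Main
    "HOL-Algebra.Group_Action"
    "HOL-Algebra.Generated_Groups"
    "HOL-Computational_Algebra.Primes"
    "HOL-Computational_Algebra.Formal_Power_Series"
begin

definition commutator :: "('a, 'b) monoid_scheme \<Rightarrow> 'a \<Rightarrow> 'a \<Rightarrow> 'a" where
  "commutator G x y = x \<otimes>\<^bsub>G\<^esub> y \<otimes>\<^bsub>G\<^esub> inv\<^bsub>G\<^esub> x \<otimes>\<^bsub>G\<^esub> inv\<^bsub>G\<^esub> y"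

definition commutator_subgroup :: "('a, 'b) monoid_scheme \<Rightarrow> 'a set \<Rightarrow> 'a set \<Rightarrow> 'a set" where
  "commutator_subgroup G H K = generate G {commutator G h k | h k. h \<in> H \<and> k \<in> K}"


subsection \<open>Conjugacy classes of commuting tuples\<close>

text \<open>Tuples are lists of length \<open>n\<close>; for \<open>n = 0\<close> there is exactly one, the empty list.\<close>

definition commuting_tuples :: "('a, 'b) monoid_scheme \<Rightarrow> nat \<Rightarrow> 'a list set" where
  "commuting_tuples G n =
     {xs. length xs = n \<and> set xs \<subseteq> carrier G \<and>
          (\<forall>i<n. \<forall>j<n. commutator G (xs ! i) (xs ! j) = \<one>\<^bsub>G\<^esub>)}"

definition simultaneous_conj ::
  "('a, 'b) monoid_scheme \<Rightarrow> nat \<Rightarrow> 'a \<Rightarrow> 'a list \<Rightarrow> 'a list" where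
  "simultaneous_conj G n g =
     (\<lambda>xs \<in> commuting_tuples G n. map (\<lambda>x. g \<otimes>\<^bsub>G\<^esub> x \<otimes>\<^bsub>G\<^esub> inv\<^bsub>G\<^esub> g) xs)"

definition commuting_orbit_count :: "('a, 'b) monoid_scheme \<Rightarrow> nat \<Rightarrow> nat" where
  "commuting_orbit_count G n =
     card (orbits G (commuting_tuples G n) (simultaneous_conj G n))"

definition commuting_orbit_fps :: "('a, 'b) monoid_scheme \<Rightarrow> rat fps" where
  "commuting_orbit_fps G = Abs_fps (\<lambda>n. of_nat (commuting_orbit_count G n))"

lemma (in group) commuting_orbit_count_0: "commuting_orbit_count G 0 = 1"
proof -
  have "commuting_tuples G 0 = {[]}"
    by (auto simp: commuting_tuples_def)
  moreover have "orbit G (simultaneous_conj G 0) [] = {[]}"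
    using calculation by (auto simp: orbit_def simultaneous_conj_def)
  ultimately show ?thesis
    by (simp add: commuting_orbit_count_def orbits_def)
qed


subsection \<open>Groups of maximal class\<close>

text \<open>Indexing starts at 1; the value at 0 is a dummy.\<close>

fun lower_central :: "('a, 'b) monoid_scheme \<Rightarrow> nat \<Rightarrow> 'a set" where
  "lower_central G 0 = carrier G"
| "lower_central G (Suc 0) = carrier G"
| "lower_central G (Suc (Suc i)) = commutator_subgroup G (lower_central G (Suc i)) (carrier G)"

definition nilpotent_group :: "('a, 'b) monoid_scheme \<Rightarrow> bool" where
  "nilpotent_group G \<longleftrightarrow> group G \<and> (\<exists>c. lower_central G (Suc c) = {\<one>\<^bsub>G\<^esub>})"

definition nilpotency_class :: "('a, 'b) monoid_scheme \<Rightarrow> nat" where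
  "nilpotency_class G = (LEAST c. lower_central G (Suc c) = {\<one>\<^bsub>G\<^esub>})"

definition maximal_class :: "('a, 'b) monoid_scheme \<Rightarrow> nat \<Rightarrow> nat \<Rightarrow> bool" where
  "maximal_class G p m \<longleftrightarrow>
     group G \<and> finite (carrier G) \<and> order G = p ^ m \<and> 4 \<le> m \<and>
     nilpotent_group G \<and> nilpotency_class G = m - 1"

definition two_step_centralizer :: "('a, 'b) monoid_scheme \<Rightarrow> nat \<Rightarrow> 'a set" where
  "two_step_centralizer G i =
     {g \<in> carrier G. \<forall>x \<in> lower_central G i. commutator G g x \<in> lower_central G (i + 2)}"

definition P_subgroup :: "('a, 'b) monoid_scheme \<Rightarrow> nat \<Rightarrow> nat \<Rightarrow> 'a set" where
  "P_subgroup G m i =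
     (if i = 0 then carrier G
      else if i = 1 then two_step_centralizer G 2
      else if i \<le> m then lower_central G i
      else {\<one>\<^bsub>G\<^esub>})"

definition abelian_subgroup :: "('a, 'b) monoid_scheme \<Rightarrow> 'a set \<Rightarrow> bool" where
  "abelian_subgroup G H \<longleftrightarrow> subgroup H G \<and> comm_group (G\<lparr>carrier := H\<rparr>)"

text \<open>
  The maximum may be taken over natural numbers: in a group of maximal class of order
  \<open>p ^ m\<close> the value \<open>l = 0\<close> is always admissible, and if \<open>P\<^sub>1\<close> is not abelian then
  \<open>i = j = 1\<close> excludes all \<open>l \<ge> m - 2\<close>.
\<close>

definition degree_of_commutativity :: "('a, 'b) monoid_scheme \<Rightarrow> nat \<Rightarrow> nat" where
  "degree_of_commutativity G m =
     (if abelian_subgroup G (P_subgroup G m 1) then m - 3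
      else (GREATEST l. \<forall>i\<ge>1. \<forall>j\<ge>1.
              commutator_subgroup G (P_subgroup G m i) (P_subgroup G m j)
                \<subseteq> P_subgroup G m (i + j + l)))"

definition maximal_subgroup :: "('a, 'b) monoid_scheme \<Rightarrow> 'a set \<Rightarrow> bool" where
  "maximal_subgroup G H \<longleftrightarrow>
     subgroup H G \<and> H \<noteq> carrier G \<and>
     (\<forall>K. subgroup K G \<longrightarrow> H \<subseteq> K \<longrightarrow> K = H \<or> K = carrier G)"

definition has_abelian_maximal_subgroup :: "('a, 'b) monoid_scheme \<Rightarrow> bool" where
  "has_abelian_maximal_subgroup G \<longleftrightarrow>
     (\<exists>H. maximal_subgroup G H \<and> abelian_subgroup G H)"


subsection \<open>Powers of the prime as constant power series\<close>

text \<open>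
  Integer exponents avoid truncated subtraction in exponents such as \<open>m - 5\<close>.
\<close>

definition fps_pow :: "nat \<Rightarrow> int \<Rightarrow> rat fps" where
  "fps_pow p k = fps_const (of_nat p powi k)"

end

theory Submission
  imports Defs
begin

text \<open>
  By Burnside's lemma \<open>|G| \<beta>\<^sub>G\<^sub>,\<^sub>n\<close> is the number \<open>c\<^sub>n\<^sub>+\<^sub>1\<close> of commuting
  \<open>(n + 1)\<close>-tuples, and splitting off the first entry gives
  \<open>c\<^sub>n\<^sub>+\<^sub>1(G) = (\<Sum>x\<in>G. c\<^sub>n(C\<^sub>G(x)))\<close>, so only the centralizers of single elements matter.
  Let \<open>M\<close> be the abelian maximal subgroup in part (1) and \<open>P\<^sub>1\<close> in part (2). An element
  outside \<open>M\<close> has an abelian centralizer of order \<open>p\<^sup>2\<close>, because its commutators with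
  \<open>\<gamma>\<^sub>i\<close> are not all contained in \<open>\<gamma>\<^sub>i\<^sub>+\<^sub>2\<close>; the centre \<open>\<gamma>\<^sub>m\<^sub>-\<^sub>1\<close> has order \<open>p\<close>; and every other element of \<open>M\<close> has its
  centralizer inside \<open>M\<close>. In part (2), \<open>Z(P\<^sub>1) = P\<^sub>3\<close> has index \<open>p\<^sup>2\<close> in \<open>P\<^sub>1\<close>, so the elements of
  \<open>P\<^sub>1 - P\<^sub>3\<close> have abelian centralizers of order \<open>p\<^bsup>m-2\<^esup>\<close>. The resulting recurrences are
  linear with geometric inhomogeneities.
\<close>

section \<open>Commutators and the lower central series\<close>

text \<open>For normal \<open>N\<close> this is the preimage in \<open>G\<close> of the centralizer
  of the image of \<open>X\<close> in \<open>G/N\<close>. With \<open>N = {\<one>}\<close> it gives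
  ordinary centralizers, and with \<open>N\<close> and \<open>X\<close> terms of the lower central
  series the 2-step centralizers, without forming quotient groups.\<close>

definition centralizer_mod :: "('a, 'b) monoid_scheme \<Rightarrow> 'a set \<Rightarrow> 'a set \<Rightarrow> 'a set" where
  "centralizer_mod G N X = {g \<in> carrier G. \<forall>x \<in> X. commutator G g x \<in> N}"

context group
begin

lemma mult_inv_cancel:
  assumes "x \<in> carrier G" "y \<in> carrier G"
  shows "x \<otimes> (inv x \<otimes> y) = y" "inv x \<otimes> (x \<otimes> y) = y"
  using assms by (simp_all flip: m_assoc)

lemma commutator_closed [simp]:
  "\<lbrakk>x \<in> carrier G; y \<in> carrier G\<rbrakk> \<Longrightarrow> commutator G x y \<in> carrier G"
  by (simp add: commutator_def)

lemma inv_commutator: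
  assumes "x \<in> carrier G" "y \<in> carrier G"
  shows "inv (commutator G x y) = commutator G y x"
  using assms by (simp add: commutator_def inv_mult_group m_assoc)

lemma commutator_eq_one_iff:
  assumes "x \<in> carrier G" "y \<in> carrier G"
  shows "commutator G x y = \<one> \<longleftrightarrow> x \<otimes> y = y \<otimes> x"
proof -
  have "commutator G x y \<otimes> (y \<otimes> x) = x \<otimes> y"
    using assms by (simp add: commutator_def m_assoc mult_inv_cancel)
  then show ?thesis
    using assms by (metis commutator_closed l_one m_closed r_cancel_one')
qed

lemma commutator_self [simp]: "x \<in> carrier G \<Longrightarrow> commutator G x x = \<one>"
  by (simp add: commutator_eq_one_iff)

lemma commutator_mem_commute:
  assumes "subgroup N G" "x \<in> carrier G" "y \<in> carrier G" "commutator G x y \<in> N"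
  shows "commutator G y x \<in> N"
  using subgroup.m_inv_closed[OF assms(1,4)] assms(2,3) by (simp add: inv_commutator)

lemma commutator_mult_left:
  assumes "g \<in> carrier G" "h \<in> carrier G" "x \<in> carrier G"
  shows "commutator G (g \<otimes> h) x = (g \<otimes> commutator G h x \<otimes> inv g) \<otimes> commutator G g x"
  using assms by (simp add: commutator_def inv_mult_group m_assoc mult_inv_cancel)

lemma commutator_inv_left:
  assumes "g \<in> carrier G" "x \<in> carrier G"
  shows "commutator G (inv g) x = inv g \<otimes> commutator G x g \<otimes> g"
  using assms by (simp add: commutator_def inv_mult_group m_assoc mult_inv_cancel)

lemma conj_commutator:
  assumes "g \<in> carrier G" "x \<in> carrier G" "y \<in> carrier G"
  shows "g \<otimes> commutator G x y \<otimes> inv g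
    = commutator G (g \<otimes> x \<otimes> inv g) (g \<otimes> y \<otimes> inv g)"
  using assms by (simp add: commutator_def inv_mult_group m_assoc mult_inv_cancel)

lemma commutator_mem_normal:
  assumes "N \<lhd> G" "x \<in> N" "g \<in> carrier G"
  shows "commutator G x g \<in> N" "commutator G g x \<in> N"
proof -
  have N: "subgroup N G" using assms(1) by (rule normal_imp_subgroup)
  have x: "x \<in> carrier G" using subgroup.mem_carrier[OF N] assms(2) .
  have "g \<otimes> x \<otimes> inv g \<in> N"
    using normal.inv_op_closed2[OF assms(1,3,2)] .
  then have "(g \<otimes> x \<otimes> inv g) \<otimes> inv x \<in> N"
    using N assms(2) by (simp add: subgroup.m_closed subgroup.m_inv_closed)
  then show *: "commutator G g x \<in> N"
    by (simp add: commutator_def)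
  show "commutator G x g \<in> N"
    using commutator_mem_commute[OF N assms(3) x *] .
qed

lemma centralizer_mod_subset: "centralizer_mod G N X \<subseteq> carrier G"
  by (auto simp: centralizer_mod_def)

lemma subgroup_centralizer_mod:
  assumes N: "N \<lhd> G" and X: "X \<subseteq> carrier G"
  shows "subgroup (centralizer_mod G N X) G"
proof
  note N' = normal_imp_subgroup[OF N]
  show "centralizer_mod G N X \<subseteq> carrier G" by (rule centralizer_mod_subset)
  show "\<one> \<in> centralizer_mod G N X"
    using X subgroup.one_closed[OF N']
    by (auto simp: centralizer_mod_def commutator_def subset_iff)
  show "g \<otimes> h \<in> centralizer_mod G N X"
    if "g \<in> centralizer_mod G N X" "h \<in> centralizer_mod G N X" for g h
    using that X unfolding centralizer_mod_def
    by (auto simp: commutator_mult_left subset_iff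
        intro!: subgroup.m_closed[OF N'] normal.inv_op_closed2[OF N])
  show "inv g \<in> centralizer_mod G N X" if "g \<in> centralizer_mod G N X" for g
  proof -
    have g: "g \<in> carrier G" using that by (simp add: centralizer_mod_def)
    have "commutator G (inv g) x \<in> N" if "x \<in> X" for x
    proof -
      have x: "x \<in> carrier G" using X that by auto
      have "commutator G x g \<in> N"
        using \<open>g \<in> centralizer_mod G N X\<close> that x g
        by (auto simp: centralizer_mod_def intro: commutator_mem_commute[OF N'])
      then show ?thesis
        using g x by (simp add: commutator_inv_left normal.inv_op_closed1[OF N])
    qed
    then show ?thesis using g by (simp add: centralizer_mod_def)
  qed
qed

lemma subgroup_centralizer: "x \<in> carrier G \<Longrightarrow> subgroup (centralizer_mod G {\<one>} {x}) G"
  by (intro subgroup_centralizer_mod one_is_normal) auto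

lemma commutator_in_commutator_subgroup:
  "\<lbrakk>h \<in> H; k \<in> K\<rbrakk> \<Longrightarrow> commutator G h k \<in> commutator_subgroup G H K"
  unfolding commutator_subgroup_def by (blast intro: generate.incl)

lemma commutator_subgroup_le_iff:
  assumes "subgroup N G"
  shows "commutator_subgroup G H K \<subseteq> N \<longleftrightarrow> (\<forall>h\<in>H. \<forall>k\<in>K. commutator G h k \<in> N)"
proof
  show "commutator_subgroup G H K \<subseteq> N" if "\<forall>h\<in>H. \<forall>k\<in>K. commutator G h k \<in> N"
    unfolding commutator_subgroup_def
    by (rule generate_subgroup_incl[OF _ assms]) (use that in auto)
qed (auto intro: commutator_in_commutator_subgroup)

text \<open>Conjugation by \<open>g\<close> sends \<open>[h, k]\<close> to the commutator of the two
  conjugates, so the generating set is already closed under conjugation.\<close>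

lemma normal_commutator_subgroup:
  assumes "N \<lhd> G"
  shows "commutator_subgroup G N (carrier G) \<lhd> G"
  unfolding commutator_subgroup_def
proof (rule normal_generateI)
  note N = normal_imp_subgroup[OF assms]
  show "{commutator G h k |h k. h \<in> N \<and> k \<in> carrier G} \<subseteq> carrier G"
    using subgroup.subset[OF N] by auto
  show "g \<otimes> x \<otimes> inv g \<in> {commutator G h k |h k. h \<in> N \<and> k \<in> carrier G}"
    if "x \<in> {commutator G h k |h k. h \<in> N \<and> k \<in> carrier G}" "g \<in> carrier G" for x g
  proof -
    from that(1) obtain h k where x: "x = commutator G h k" "h \<in> N" "k \<in> carrier G"
      by auto
    have "g \<otimes> x \<otimes> inv g = commutator G (g \<otimes> h \<otimes> inv g) (g \<otimes> k \<otimes> inv g)"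
      using x that(2) subgroup.mem_carrier[OF N] by (simp add: conj_commutator)
    moreover have "g \<otimes> h \<otimes> inv g \<in> N" "g \<otimes> k \<otimes> inv g \<in> carrier G"
      using x that(2) normal.inv_op_closed2[OF assms that(2)] by auto
    ultimately show ?thesis by blast
  qed
qed

lemma normal_lower_central: "lower_central G i \<lhd> G"
proof (induction G\<equiv>G i rule: lower_central.induct)
  case (3 i)
  then show ?case by (simp add: normal_commutator_subgroup)
qed (auto intro: normal_self)

lemma subgroup_lower_central: "subgroup (lower_central G i) G"
  using normal_lower_central by (rule normal_imp_subgroup)

lemma lower_central_subset: "lower_central G i \<subseteq> carrier G"
  using subgroup_lower_central by (rule subgroup.subset)

text \<open>Indices 0 and 1 both stand for the whole group, so the recursion can fail at index 0;
  hence the recurring hypothesis \<open>1 \<le> i\<close>.\<close>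

lemma lower_central_Suc:
  "1 \<le> i \<Longrightarrow> lower_central G (Suc i) = commutator_subgroup G (lower_central G i) (carrier G)"
  by (cases i) auto

declare lower_central.simps(3) [simp del]

lemma commutator_in_lower_central:
  assumes "x \<in> lower_central G i" "g \<in> carrier G" "1 \<le> i"
  shows "commutator G x g \<in> lower_central G (Suc i)" "commutator G g x \<in> lower_central G (Suc i)"
proof -
  show *: "commutator G x g \<in> lower_central G (Suc i)"
    using assms by (simp add: lower_central_Suc commutator_in_commutator_subgroup)
  show "commutator G g x \<in> lower_central G (Suc i)"
    using commutator_mem_commute[OF subgroup_lower_central _ _ *] assms lower_central_subset by auto
qed

lemma lower_central_Suc_le_iff:
  assumes "subgroup N G" "1 \<le> i"
  shows "lower_central G (Suc i) \<subseteq> N \<longleftrightarrow>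
    (\<forall>x\<in>lower_central G i. \<forall>g\<in>carrier G. commutator G x g \<in> N)"
  using assms by (simp add: lower_central_Suc commutator_subgroup_le_iff)

lemma lower_central_Suc_subset: "lower_central G (Suc i) \<subseteq> lower_central G i"
proof (cases "i = 0")
  case False
  then show ?thesis
    using normal_lower_central[of i] subgroup_lower_central[of i]
    by (auto simp: lower_central_Suc_le_iff commutator_mem_normal)
qed simp

lemma lower_central_antimono: "i \<le> j \<Longrightarrow> lower_central G j \<subseteq> lower_central G i"
  using lift_Suc_antimono_le[of "lower_central G"] lower_central_Suc_subset by blast

text \<open>Each term is determined by its predecessor, so one repetition freezes the series. This
  later makes the inclusions strict until the trivial subgroup is reached.\<close>

lemma lower_central_stable:
  assumes "lower_central G (Suc i) = lower_central G i" "1 \<le> i" "i \<le> j"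
  shows "lower_central G j = lower_central G i"
  using assms(3)
proof (induction rule: dec_induct)
  case (step n)
  then show ?case using assms by (simp add: lower_central_Suc)
qed simp

end

section \<open>Finite p-groups and groups of maximal class\<close>

context group
begin

lemma rcos_eq_iff:
  assumes N: "subgroup N G" and gh: "g \<in> carrier G" "h \<in> carrier G"
  shows "N #> g = N #> h \<longleftrightarrow> h \<otimes> inv g \<in> N"
proof -
  have "N #> g = N #> h \<longleftrightarrow> h \<in> N #> g"
    using gh N by (metis repr_independence rcos_self)
  also have "\<dots> \<longleftrightarrow> h \<otimes> inv g \<in> N"
  proof
    assume "h \<in> N #> g"
    then obtain k where k: "k \<in> N" "h = k \<otimes> g" by (auto simp: r_coset_def)
    then show "h \<otimes> inv g \<in> N"
      using gh subgroup.mem_carrier[OF N k(1)] by (simp add: m_assoc)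
  next
    assume "h \<otimes> inv g \<in> N"
    moreover have "h = (h \<otimes> inv g) \<otimes> g" using gh by (simp add: m_assoc)
    ultimately show "h \<in> N #> g" unfolding r_coset_def by blast
  qed
  finally show ?thesis .
qed

text \<open>The fibres of \<open>f\<close> on \<open>C\<close> are right cosets of \<open>K\<close>,
  all of size \<open>card K\<close>. Since \<open>f\<close> may be any function, this covers coset
  maps as well as \<open>g \<mapsto> [g, y]\<close> modulo a subgroup.\<close>

lemma card_eq_card_image_times:
  assumes K: "subgroup K G" and C: "subgroup C G" and "finite C" and "K \<subseteq> C"
    and f: "\<And>g h. \<lbrakk>g \<in> C; h \<in> C\<rbrakk> \<Longrightarrow> f g = f h \<longleftrightarrow> h \<otimes> inv g \<in> K"
  shows "card C = card (f ` C) * card K"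
proof -
  have fib: "card {h \<in> C. f h = y} = card K" if "y \<in> f ` C" for y
  proof -
    obtain g where g: "g \<in> C" "y = f g" using \<open>y \<in> f ` C\<close> by auto
    have gc: "g \<in> carrier G" using subgroup.mem_carrier[OF C g(1)] .
    have "{h \<in> C. f h = y} = K #> g"
    proof (intro equalityI subsetI)
      fix h assume "h \<in> {h \<in> C. f h = y}"
      then have h: "h \<in> C" "h \<otimes> inv g \<in> K" using g f[of g h] by auto
      then have "h = (h \<otimes> inv g) \<otimes> g"
        using gc subgroup.mem_carrier[OF C] by (simp add: m_assoc)
      then show "h \<in> K #> g" using h unfolding r_coset_def by blast
    next
      fix h assume "h \<in> K #> g"
      then obtain k where k: "k \<in> K" "h = k \<otimes> g" by (auto simp: r_coset_def)
      then have "h \<in> C" "h \<otimes> inv g = k"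
        using g \<open>K \<subseteq> C\<close> C gc subgroup.mem_carrier[OF K] by (auto simp: m_assoc subgroup.m_closed)
      then show "h \<in> {h \<in> C. f h = y}" using g f[of g h] k by auto
    qed
    then show ?thesis
      using card_rcosets_equal[OF rcosetsI[OF _ gc, of K]] subgroup.subset[OF K] by simp
  qed
  have "card C = card (\<Union>y\<in>f ` C. {h \<in> C. f h = y})"
    by (rule arg_cong[of _ _ card]) auto
  also have "\<dots> = (\<Sum>y\<in>f ` C. card {h \<in> C. f h = y})"
    using \<open>finite C\<close> by (intro card_UN_disjoint) auto
  also have "\<dots> = card (f ` C) * card K"
    using fib by simp
  finally show ?thesis .
qed

text \<open>The map \<open>g \<mapsto> M #> g\<close> on \<open>C\<close> has the cosets of
  \<open>C \<inter> M\<close> as fibres and takes at most \<open>n\<close> values.\<close>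

lemma card_le_index_times_card_Int:
  assumes "finite (carrier G)" and M: "subgroup M G" and C: "subgroup C G"
    and index: "order G = n * card M"
  shows "card C \<le> n * card (C \<inter> M)"
proof -
  have "card C = card ((\<lambda>g. M #> g) ` C) * card (C \<inter> M)"
  proof (rule card_eq_card_image_times)
    show "M #> g = M #> h \<longleftrightarrow> h \<otimes> inv g \<in> C \<inter> M" if "g \<in> C" "h \<in> C" for g h
      using that C subgroup.mem_carrier[OF C]
      by (simp add: rcos_eq_iff[OF M] subgroup.m_closed subgroup.m_inv_closed)
    show "finite C" using assms(1) subgroup.subset[OF C] by (rule rev_finite_subset)
  qed (use M C in \<open>auto intro: subgroups_Inter_pair\<close>)
  moreover have "card ((\<lambda>g. M #> g) ` C) \<le> n"
  proof -
    have "(\<lambda>g. M #> g) ` C \<subseteq> rcosets M"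
      using subgroup.mem_carrier[OF C] subgroup.subset[OF M] by (auto simp: rcosetsI)
    then have "card ((\<lambda>g. M #> g) ` C) \<le> card (rcosets M)"
      using rcosets_part_G[OF M] assms(1) by (intro card_mono) (auto intro: finite_UnionD)
    moreover have "card (rcosets M) * card M = n * card M" "0 < card M"
      using lagrange[OF M] index subgroup.finite_imp_card_positive[OF M] assms(1) by auto
    ultimately show ?thesis by simp
  qed
  ultimately show ?thesis by simp
qed

end

locale finite_p_group = group G for G (structure) +
  fixes p m :: nat
  assumes prime_p: "prime p" and order_eq: "order G = p ^ m"
begin

lemma p_gt_1: "1 < p"
  using prime_p by (rule prime_gt_1_nat)

lemma finite_carrier [simp]: "finite (carrier G)"
  using order_eq p_gt_1 by (metis card.infinite order_def power_not_zero not_one_less_zero)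

lemma finite_subgroup: "subgroup H G \<Longrightarrow> finite H"
  using finite_carrier subgroup.subset finite_subset by blast

lemma card_subgroup_prime_power:
  assumes "subgroup H G"
  shows "\<exists>k\<le>m. card H = p ^ k"
  using lagrange[OF assms] order_eq divides_primepow_nat[OF prime_p, of "card H" m]
  by (metis dvd_triv_right)

text \<open>Both orders are powers of \<open>p\<close>, so a strict inclusion costs at least a
  factor \<open>p\<close>. Most orders below are found by squeezing with this inequality.\<close>

lemma card_psubset_subgroup:
  assumes H: "subgroup H G" and K: "subgroup K G" and "K \<subset> H"
  shows "p * card K \<le> card H"
proof -
  obtain a b where ab: "card H = p ^ a" "card K = p ^ b"
    using card_subgroup_prime_power[OF H] card_subgroup_prime_power[OF K] by auto
  have "card K < card H"
    using \<open>K \<subset> H\<close> finite_subgroup[OF H] by (simp add: psubset_card_mono)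
  then have "b < a" using ab p_gt_1 by simp
  then have "p ^ Suc b \<le> p ^ a" using p_gt_1 by (intro power_increasing) auto
  then show ?thesis using ab by simp
qed

lemma card_subgroup_pos: "subgroup H G \<Longrightarrow> 0 < card H"
  using subgroup.finite_imp_card_positive by fastforce

text \<open>The recurring device: to extend a property from \<open>K\<close> to \<open>H\<close>,
  let \<open>D\<close> be the subgroup of elements having it and exhibit one such element outside
  \<open>K\<close>.\<close>

lemma subgroup_index_p_maximal:
  assumes K: "subgroup K G" and H: "subgroup H G" and D: "subgroup D G"
    and card: "card H = p * card K" and "K \<subseteq> D" "y \<in> D" "y \<notin> K" "D \<subseteq> H"
  shows "D = H"
proof -
  have "p * card K \<le> card D"
    using assms by (intro card_psubset_subgroup) auto
  then show ?thesis
    using card \<open>D \<subseteq> H\<close> finite_subgroup[OF H] by (simp add: card_seteq)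
qed

text \<open>For \<open>K \<subseteq> Z(H)\<close> and \<open>N = 1\<close> this says that a group which is cyclic modulo a central
  subgroup is abelian. Instead of powers of a generator, the proof uses that the elements of
  \<open>H\<close> commuting with a given one modulo \<open>N\<close> form a subgroup strictly above \<open>K\<close>.\<close>

lemma commutator_mem_of_index_p:
  assumes K: "subgroup K G" and H: "subgroup H G" and N: "N \<lhd> G"
    and card: "card H = p * card K" and "K \<subseteq> H"
    and comm: "\<And>k h. \<lbrakk>k \<in> K; h \<in> H\<rbrakk> \<Longrightarrow> commutator G k h \<in> N"
    and "g \<in> H" "h \<in> H"
  shows "commutator G g h \<in> N"
proof (cases "h \<in> K")
  case True
  then show ?thesis
    using commutator_mem_commute[OF normal_imp_subgroup[OF N], of h g] comm[of h g]
      \<open>g \<in> H\<close> \<open>h \<in> H\<close> subgroup.mem_carrier[OF H] by simp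
next
  case False
  have h: "h \<in> carrier G" using subgroup.mem_carrier[OF H \<open>h \<in> H\<close>] .
  have "H \<inter> centralizer_mod G N {h} = H"
  proof (rule subgroup_index_p_maximal[OF K H])
    show "subgroup (H \<inter> centralizer_mod G N {h}) G"
      using H subgroup_centralizer_mod[OF N, of "{h}"] h by (intro subgroups_Inter_pair) auto
    show "K \<subseteq> H \<inter> centralizer_mod G N {h}"
      using comm \<open>K \<subseteq> H\<close> \<open>h \<in> H\<close> subgroup.mem_carrier[OF K] by (auto simp: centralizer_mod_def)
    show "h \<in> H \<inter> centralizer_mod G N {h}"
      using h \<open>h \<in> H\<close> subgroup.one_closed[OF normal_imp_subgroup[OF N]]
      by (simp add: centralizer_mod_def)
  qed (use card False in auto)
  then show ?thesis using \<open>g \<in> H\<close> by (auto simp: centralizer_mod_def)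
qed

end

text \<open>The last assumption states nilpotency class \<open>m - 1\<close> in the form in which it
  is used: the series reaches the trivial subgroup exactly at index \<open>m\<close>.\<close>

locale maximal_class_group = finite_p_group +
  assumes four_le_m: "4 \<le> m"
    and lower_central_trivial_iff: "\<And>i. 1 \<le> i \<Longrightarrow> lower_central G i = {\<one>} \<longleftrightarrow> m \<le> i"
begin

lemma lower_central_psubset:
  assumes "1 \<le> i" "i < m"
  shows "lower_central G (Suc i) \<subset> lower_central G i"
proof -
  have "lower_central G (Suc i) \<noteq> lower_central G i"
    using lower_central_stable[of i m] lower_central_trivial_iff[of i]
      lower_central_trivial_iff[of m] assms by auto
  then show ?thesis using lower_central_Suc_subset by blast
qed

lemma not_lower_central_subset:
  assumes "1 \<le> i" "i < m"
  shows "\<not> lower_central G i \<subseteq> lower_central G (Suc i)"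
  using lower_central_psubset[OF assms] by auto

lemma card_lower_central_ge:
  assumes "1 \<le> i" "i \<le> j" "j \<le> m"
  shows "p ^ (j - i) * card (lower_central G j) \<le> card (lower_central G i)"
  using assms(2,3)
proof (induction rule: dec_induct)
  case (step n)
  have "p * card (lower_central G (Suc n)) \<le> card (lower_central G n)"
    using step assms(1)
    by (intro card_psubset_subgroup subgroup_lower_central lower_central_psubset) auto
  then have "p ^ (n - i) * (p * card (lower_central G (Suc n))) \<le> p ^ (n - i) * card (lower_central G n)"
    by (rule mult_le_mono2)
  also have "\<dots> \<le> card (lower_central G i)" using step by simp
  finally show ?case using step by (simp add: Suc_diff_le mult.assoc mult.left_commute)
qed simp

text \<open>If \<open>\<gamma>\<^sub>2\<close> had index \<open>p\<close>, then
  \<open>G/\<gamma>\<^sub>3\<close> would be cyclic modulo the central subgroup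
  \<open>\<gamma>\<^sub>2/\<gamma>\<^sub>3\<close>, hence abelian, and
  \<open>\<gamma>\<^sub>2 \<subseteq> \<gamma>\<^sub>3\<close> would follow.\<close>

lemma index_lower_central_2: "p\<^sup>2 * card (lower_central G 2) \<le> order G"
proof -
  obtain a where a: "card (lower_central G 2) = p ^ a"
    using card_subgroup_prime_power[OF subgroup_lower_central[of 2]] by auto
  have "p * card (lower_central G 2) \<noteq> order G"
  proof
    assume "p * card (lower_central G 2) = order G"
    then have "commutator G g h \<in> lower_central G 3" if "g \<in> carrier G" "h \<in> carrier G" for g h
      using that commutator_in_lower_central[of _ 2]
      by - (rule commutator_mem_of_index_p[OF subgroup_lower_central subgroup_self
            normal_lower_central _ lower_central_subset], auto simp: order_def)
    then have "lower_central G 2 \<subseteq> lower_central G 3"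
      using lower_central_Suc_le_iff[OF subgroup_lower_central, of 1 3] by (simp add: numeral_2_eq_2)
    then show False
      using not_lower_central_subset[of 2] four_le_m by simp
  qed
  moreover have "p * card (lower_central G 2) \<le> order G"
    using card_psubset_subgroup[OF subgroup_self subgroup_lower_central[of 2]]
      lower_central_psubset[of 1] four_le_m by (simp add: order_def numeral_2_eq_2)
  ultimately have "p ^ Suc a < p ^ m" using a order_eq by simp
  then have "Suc a < m" by (rule power_less_imp_less_exp[OF p_gt_1])
  then have "p ^ (a + 2) \<le> p ^ m" using p_gt_1 by (intro power_increasing) auto
  then show ?thesis using a order_eq by (simp add: power_add power2_eq_square mult_ac)
qed

text \<open>A squeeze: strictness of the series below \<open>\<gamma>\<^sub>i\<close> gives at least
  \<open>p ^ (m - i)\<close> elements, while the factor \<open>p\<^sup>2\<close> at the top and the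
  strict steps from \<open>\<gamma>\<^sub>2\<close> to \<open>\<gamma>\<^sub>i\<close> already use
  up \<open>p ^ i\<close> of the order \<open>p ^ m\<close>.\<close>

lemma card_lower_central:
  assumes "2 \<le> i" "i \<le> m"
  shows "card (lower_central G i) = p ^ (m - i)"
proof (rule antisym)
  have "lower_central G m = {\<one>}" using lower_central_trivial_iff[of m] four_le_m by simp
  then show "p ^ (m - i) \<le> card (lower_central G i)"
    using card_lower_central_ge[of i m] assms by simp
  have "p ^ i * card (lower_central G i) = p\<^sup>2 * (p ^ (i - 2) * card (lower_central G i))"
  proof -
    have "p ^ i = p ^ (2 + (i - 2))" using assms by (simp only: le_add_diff_inverse)
    also have "\<dots> = p\<^sup>2 * p ^ (i - 2)" by (rule power_add)
    finally show ?thesis by (simp only: mult.assoc)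
  qed
  also have "\<dots> \<le> p\<^sup>2 * card (lower_central G 2)"
    using card_lower_central_ge[of 2 i] assms by simp
  also have "\<dots> \<le> p ^ i * p ^ (m - i)"
    using index_lower_central_2 order_eq assms by (simp flip: power_add)
  finally show "card (lower_central G i) \<le> p ^ (m - i)"
    using p_gt_1 by simp
qed

end

section \<open>The 2-step centralizer \<open>P\<^sub>1\<close> and its index\<close>

context group
begin

lemma subgroup_mult_mem_iff:
  assumes "subgroup H G" "h \<in> H" "g \<in> carrier G"
  shows "h \<otimes> g \<in> H \<longleftrightarrow> g \<in> H"
proof
  assume "h \<otimes> g \<in> H"
  then have "inv h \<otimes> (h \<otimes> g) \<in> H"
    using assms by (simp add: subgroup.m_closed subgroup.m_inv_closed)
  then show "g \<in> H"
    using assms subgroup.mem_carrier[OF assms(1,2)] by (simp add: mult_inv_cancel)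
qed (use assms in \<open>simp add: subgroup.m_closed\<close>)

lemma normal_conj_iff:
  assumes N: "N \<lhd> G" and gh: "g \<in> carrier G" "h \<in> carrier G"
  shows "g \<otimes> h \<otimes> inv g \<in> N \<longleftrightarrow> h \<in> N"
proof
  assume "g \<otimes> h \<otimes> inv g \<in> N"
  from normal.inv_op_closed1[OF N gh(1) this] show "h \<in> N"
    using gh by (simp add: m_assoc mult_inv_cancel)
qed (use normal.inv_op_closed2[OF N gh(1)] in simp)

lemma two_step_centralizer_eq:
  "two_step_centralizer G i = centralizer_mod G (lower_central G (i + 2)) (lower_central G i)"
  by (simp add: two_step_centralizer_def centralizer_mod_def)

lemma subgroup_two_step_centralizer: "subgroup (two_step_centralizer G i) G"
  unfolding two_step_centralizer_eq
  by (intro subgroup_centralizer_mod normal_lower_central lower_central_subset)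

end

context maximal_class_group
begin

lemma card_lower_central_Suc:
  assumes "2 \<le> i" "i < m"
  shows "card (lower_central G i) = p * card (lower_central G (Suc i))"
  using assms by (simp add: card_lower_central Suc_diff_Suc flip: power_Suc)

text \<open>For a fixed \<open>y\<close> in \<open>\<gamma>\<^sub>2 - \<gamma>\<^sub>3\<close>, the
  map sending \<open>g\<close> to \<open>[g, y]\<close> modulo \<open>\<gamma>\<^sub>4\<close> takes
  values in \<open>\<gamma>\<^sub>3/\<gamma>\<^sub>4\<close>, of order \<open>p\<close>, and its
  fibres are cosets of the 2-step centralizer; so the index is at most \<open>p\<close>. It is at
  least \<open>p\<close>, because otherwise
  \<open>\<gamma>\<^sub>3 \<subseteq> \<gamma>\<^sub>4\<close>.\<close>

lemma order_eq_card_two_step_centralizer_2: "order G = p * card (two_step_centralizer G 2)"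
proof (rule antisym)
  let ?M = "two_step_centralizer G 2"
  have [simp]: "Suc 2 = 3" "Suc 3 = 4" by simp_all
  obtain y where y: "y \<in> lower_central G 2" "y \<notin> lower_central G 3"
    using not_lower_central_subset[of 2] four_le_m by auto
  have yc: "y \<in> carrier G" using y lower_central_subset by auto
  \<comment> \<open>The single element \<open>y\<close> decides membership: the elements of
    \<open>\<gamma>\<^sub>2\<close> commuting with \<open>g\<close> modulo
    \<open>\<gamma>\<^sub>4\<close> include \<open>\<gamma>\<^sub>3\<close>, which has index
    \<open>p\<close> in \<open>\<gamma>\<^sub>2\<close>, and \<open>y\<close>.\<close>
  have M: "g \<in> ?M \<longleftrightarrow> commutator G g y \<in> lower_central G 4" if g: "g \<in> carrier G" for g
  proof
    assume gy: "commutator G g y \<in> lower_central G 4"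
    let ?D = "lower_central G 2 \<inter> centralizer_mod G (lower_central G 4) {g}"
    have "?D = lower_central G 2"
    proof (rule subgroup_index_p_maximal)
      show "subgroup (lower_central G 3) G" "subgroup (lower_central G 2) G"
        by (rule subgroup_lower_central)+
      show "subgroup ?D G"
        using g by (intro subgroups_Inter_pair subgroup_lower_central subgroup_centralizer_mod
            normal_lower_central) auto
      show "card (lower_central G 2) = p * card (lower_central G 3)"
        using card_lower_central_Suc[of 2] four_le_m by simp
      show "lower_central G 3 \<subseteq> ?D"
        using lower_central_antimono[of 2 3] lower_central_subset commutator_in_lower_central(1)[of _ 3 g] g
        by (auto simp: centralizer_mod_def)
      show "y \<in> ?D"
        using y yc g commutator_mem_commute[OF subgroup_lower_central _ _ gy]
        by (auto simp: centralizer_mod_def)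
    qed (use y in auto)
    then have "commutator G x g \<in> lower_central G 4" if "x \<in> lower_central G 2" for x
      using that unfolding centralizer_mod_def by auto
    then show "g \<in> ?M"
      using g lower_central_subset[of 2] commutator_mem_commute[OF subgroup_lower_central, of _ g 4]
      by (auto simp: two_step_centralizer_def)
  qed (use y in \<open>auto simp: two_step_centralizer_def\<close>)
  have "?M \<noteq> carrier G"
  proof
    assume "?M = carrier G"
    then have "commutator G x g \<in> lower_central G 4"
      if "x \<in> lower_central G 2" "g \<in> carrier G" for x g
      using that lower_central_subset[of 2] commutator_mem_commute[OF subgroup_lower_central, of g x 4]
      by (auto simp: two_step_centralizer_def)
    then have "lower_central G (Suc 2) \<subseteq> lower_central G 4"
      by (subst lower_central_Suc_le_iff[OF subgroup_lower_central]) auto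
    then show False using not_lower_central_subset[of 3] four_le_m by simp
  qed
  then have "?M \<subset> carrier G"
    using subgroup.subset[OF subgroup_two_step_centralizer] by auto
  then show "p * card ?M \<le> order G"
    using card_psubset_subgroup[OF subgroup_self subgroup_two_step_centralizer] by (simp add: order_def)
  let ?r = "\<lambda>z. lower_central G 4 #> z"
  let ?f = "\<lambda>g. ?r (commutator G g y)"
  have "?f g = ?f h \<longleftrightarrow> h \<otimes> inv g \<in> ?M" if gh: "g \<in> carrier G" "h \<in> carrier G" for g h
  proof -
    define k c where "k = h \<otimes> inv g" and "c = commutator G g y"
    have kc: "k \<in> carrier G" "c \<in> carrier G" "c \<in> lower_central G 3"
      using gh yc y commutator_in_lower_central(2)[of y 2 g] by (auto simp: k_def c_def)
    have "h = k \<otimes> g" using gh by (simp add: k_def m_assoc)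
    then have eq: "commutator G h y = (k \<otimes> c \<otimes> inv k) \<otimes> commutator G k y"
      using commutator_mult_left[of k g y] gh yc kc by (simp add: c_def)
    have "?f g = ?f h \<longleftrightarrow> commutator G h y \<otimes> inv c \<in> lower_central G 4"
      using gh yc unfolding c_def by (intro rcos_eq_iff subgroup_lower_central) auto
    also have "commutator G h y \<otimes> inv c = commutator G k c \<otimes> (c \<otimes> commutator G k y \<otimes> inv c)"
      using kc yc unfolding eq by (simp add: m_assoc mult_inv_cancel commutator_def[of G k c])
    also have "\<dots> \<in> lower_central G 4 \<longleftrightarrow> c \<otimes> commutator G k y \<otimes> inv c \<in> lower_central G 4"
      using kc yc commutator_in_lower_central(2)[of c 3 k] subgroup_lower_central
      by (intro subgroup_mult_mem_iff) auto
    also have "\<dots> \<longleftrightarrow> commutator G k y \<in> lower_central G 4"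
      using kc yc by (intro normal_conj_iff normal_lower_central) auto
    also have "\<dots> \<longleftrightarrow> k \<in> ?M" using kc by (simp add: M)
    finally show ?thesis unfolding k_def .
  qed
  then have "order G = card (?f ` carrier G) * card ?M"
    unfolding order_def using subgroup_two_step_centralizer subgroup_self
    by (intro card_eq_card_image_times) (auto simp: subgroup.subset)
  moreover have "card (?f ` carrier G) \<le> card (?r ` lower_central G 3)"
  proof (rule card_mono)
    show "finite (?r ` lower_central G 3)"
      using finite_subgroup[OF subgroup_lower_central] by auto
    show "?f ` carrier G \<subseteq> ?r ` lower_central G 3"
      using y commutator_in_lower_central(2)[of y 2] by auto
  qed
  moreover have "card (?r ` lower_central G 3) = p"
  proof -
    have "card (lower_central G 3) = card (?r ` lower_central G 3) * card (lower_central G 4)"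
      using finite_subgroup[OF subgroup_lower_central] lower_central_antimono[of 3 4] lower_central_subset
      by (intro card_eq_card_image_times subgroup_lower_central rcos_eq_iff) auto
    then show ?thesis
      using card_lower_central_Suc[of 3] card_subgroup_pos[OF subgroup_lower_central[of 4]] four_le_m
      by simp
  qed
  ultimately show "order G \<le> p * card ?M" by (metis mult_le_mono1)
qed

end

section \<open>Centralizers in a group of maximal class\<close>

context maximal_class_group
begin

text \<open>The quotient \<open>\<gamma>\<^sub>2/\<gamma>\<^sub>4\<close> is abelian, being cyclic
  modulo \<open>\<gamma>\<^sub>3/\<gamma>\<^sub>4\<close>, which is central in
  \<open>G/\<gamma>\<^sub>4\<close>.\<close>

lemma lower_central_2_subset_two_step_centralizer: "lower_central G 2 \<subseteq> two_step_centralizer G 2"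
proof
  fix x assume x: "x \<in> lower_central G 2"
  have "commutator G x y \<in> lower_central G 4" if "y \<in> lower_central G 2" for y
  proof (rule commutator_mem_of_index_p[OF subgroup_lower_central subgroup_lower_central
        normal_lower_central _ _ _ x that])
    show "card (lower_central G 2) = p * card (lower_central G 3)"
      using card_lower_central_Suc[of 2] four_le_m by simp
    show "commutator G k h \<in> lower_central G 4"
      if "k \<in> lower_central G 3" "h \<in> lower_central G 2" for k h
      using that commutator_in_lower_central(1)[of k 3 h] lower_central_subset[of 2] by auto
  qed (rule lower_central_antimono, simp)
  then show "x \<in> two_step_centralizer G 2"
    using x lower_central_subset by (auto simp: two_step_centralizer_def)
qed

lemma card_two_step_centralizer_2: "card (two_step_centralizer G 2) = p ^ (m - 1)"
proof -
  have "p * card (two_step_centralizer G 2) = p * p ^ (m - 1)"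
    using order_eq_card_two_step_centralizer_2 order_eq four_le_m by (simp flip: power_Suc)
  then show ?thesis using p_gt_1 by simp
qed

lemma lower_central_last_central:
  assumes "z \<in> lower_central G (m - 1)" "g \<in> carrier G"
  shows "commutator G z g = \<one>" "commutator G g z = \<one>"
  using commutator_in_lower_central[OF assms] lower_central_trivial_iff[of m] four_le_m by auto

end

text \<open>The role of \<open>M\<close> is played by the abelian maximal subgroup in part (1) and by \<open>P\<^sub>1\<close>
  in part (2).\<close>

locale maximal_class_group_uniform = maximal_class_group +
  fixes M
  assumes subgroup_M: "subgroup M G" and card_M: "card M = p ^ (m - 1)"
    and lower_central_2_subset_M: "lower_central G 2 \<subseteq> M"
    and commutator_M_lower_central:
      "\<And>i x y. \<lbrakk>2 \<le> i; x \<in> M; y \<in> lower_central G i\<rbrakk> \<Longrightarrow> commutator G x y \<in> lower_central G (i + 2)"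
begin

lemma order_eq_p_card_M: "order G = p * card M"
  using order_eq card_M four_le_m by (simp flip: power_Suc)

lemma M_subset: "M \<subseteq> carrier G"
  using subgroup_M by (rule subgroup.subset)

lemma card_M_eq: "card M = p * card (lower_central G 2)"
proof -
  have "m - 1 = Suc (m - 2)" using four_le_m by simp
  then show ?thesis using card_M card_lower_central[of 2] four_le_m by simp
qed

text \<open>The quotient \<open>M/\<gamma>\<^sub>3\<close> is cyclic modulo the central subgroup
  \<open>\<gamma>\<^sub>2/\<gamma>\<^sub>3\<close>. This lets \<open>M\<close> serve as the top term
  above \<open>\<gamma>\<^sub>2\<close> in the descent below.\<close>

lemma commutator_M_M:
  assumes "x \<in> M" "y \<in> M"
  shows "commutator G x y \<in> lower_central G 3"
proof (rule commutator_mem_of_index_p[OF subgroup_lower_central subgroup_M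
      normal_lower_central card_M_eq lower_central_2_subset_M _ assms])
  show "commutator G k h \<in> lower_central G 3" if "k \<in> lower_central G 2" "h \<in> M" for k h
    using that commutator_in_lower_central(1)[of k 2 h] M_subset by auto
qed

text \<open>If \<open>s \<notin> M\<close> commuted with some \<open>y\<close> generating \<open>P\<close> modulo the next term \<open>\<gamma>\<^sub>j\<close>,
  then all of \<open>G\<close> would centralize \<open>P\<close> modulo \<open>\<gamma>\<^sub>j\<^sub>+\<^sub>1\<close>.\<close>

lemma commutator_mem_of_outside_commuting:
  assumes s: "s \<in> carrier G" "s \<notin> M"
    and P: "subgroup P G" "card P = p * card (lower_central G j)" "lower_central G j \<subseteq> P" "1 \<le> j"
    and MP: "\<And>x u. \<lbrakk>x \<in> M; u \<in> P\<rbrakk> \<Longrightarrow> commutator G x u \<in> lower_central G (Suc j)"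
    and y: "y \<in> P" "y \<notin> lower_central G j" "commutator G s y = \<one>"
    and u: "u \<in> P" "g \<in> carrier G"
  shows "commutator G u g \<in> lower_central G (Suc j)"
proof -
  let ?N = "lower_central G (Suc j)"
  have yc: "y \<in> carrier G" using subgroup.mem_carrier[OF P(1) y(1)] .
  \<comment> \<open>The index-\<open>p\<close> device is applied twice: \<open>M\<close> and
    \<open>s\<close> fill \<open>G\<close>, so every element centralizes \<open>y\<close> modulo
    \<open>?N\<close>; then \<open>\<gamma>\<^sub>j\<close> and \<open>y\<close> fill
    \<open>P\<close>, so \<open>g\<close> centralizes all of \<open>P\<close> modulo
    \<open>?N\<close>.\<close>
  have "centralizer_mod G ?N {y} = carrier G"
  proof (rule subgroup_index_p_maximal[OF subgroup_M subgroup_self])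
    show "subgroup (centralizer_mod G ?N {y}) G"
      using yc by (intro subgroup_centralizer_mod normal_lower_central) auto
    show "card (carrier G) = p * card M" using order_eq_p_card_M by (simp add: order_def)
    show "M \<subseteq> centralizer_mod G ?N {y}"
      using MP y M_subset by (auto simp: centralizer_mod_def)
    show "s \<in> centralizer_mod G ?N {y}"
      using s y subgroup.one_closed[OF subgroup_lower_central] by (auto simp: centralizer_mod_def)
  qed (use s centralizer_mod_subset in auto)
  then have yg: "commutator G g y \<in> ?N" using u by (auto simp: centralizer_mod_def)
  have "P \<inter> centralizer_mod G ?N {g} = P"
  proof (rule subgroup_index_p_maximal[OF subgroup_lower_central P(1) _ P(2)])
    show "subgroup (P \<inter> centralizer_mod G ?N {g}) G"
      using u by (intro subgroups_Inter_pair P(1) subgroup_centralizer_mod normal_lower_central) auto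
    show "lower_central G j \<subseteq> P \<inter> centralizer_mod G ?N {g}"
      using P u commutator_in_lower_central(1)[of _ j g] lower_central_subset
      by (auto simp: centralizer_mod_def)
    show "y \<in> P \<inter> centralizer_mod G ?N {g}"
      using y yc u commutator_mem_commute[OF subgroup_lower_central _ _ yg]
      by (auto simp: centralizer_mod_def)
  qed (use y in auto)
  then show ?thesis using u by (auto simp: centralizer_mod_def)
qed

text \<open>Descent along \<open>M\<close>, \<open>\<gamma>\<^sub>2\<close>, ...,
  \<open>\<gamma>\<^sub>m\<^sub>-\<^sub>1\<close>: at the first term that \<open>y\<close> misses,
  the previous lemma forces two consecutive terms of the lower central series to coincide too
  early.\<close>

lemma commuting_outside_M:
  assumes s: "s \<in> carrier G" "s \<notin> M" and y: "y \<in> M" "commutator G s y = \<one>"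
  shows "y \<in> lower_central G (m - 1)"
proof -
  have y2: "y \<in> lower_central G 2"
  proof (rule ccontr)
    assume "y \<notin> lower_central G 2"
    then have MG: "commutator G u g \<in> lower_central G 3" if "u \<in> M" "g \<in> carrier G" for u g
      using commutator_mem_of_outside_commuting[OF s subgroup_M card_M_eq lower_central_2_subset_M
          _ _ y(1) _ y(2) that] commutator_M_M by simp
    \<comment> \<open>Now \<open>M\<close> is central modulo \<open>\<gamma>\<^sub>3\<close> and has
      index \<open>p\<close> in \<open>G\<close>, so \<open>G/\<gamma>\<^sub>3\<close> would be
      abelian.\<close>
    have "commutator G g h \<in> lower_central G 3" if "g \<in> carrier G" "h \<in> carrier G" for g h
      using commutator_mem_of_index_p[OF subgroup_M subgroup_self normal_lower_central _ M_subset MG that]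
        order_eq_p_card_M by (simp add: order_def)
    then have "lower_central G 2 \<subseteq> lower_central G 3"
      using lower_central_Suc_le_iff[OF subgroup_lower_central, of 1 3] by (simp add: numeral_2_eq_2)
    then show False using not_lower_central_subset[of 2] four_le_m by simp
  qed
  have "y \<in> lower_central G i" if "2 \<le> i" "i \<le> m - 1" for i
    using that
  proof (induction rule: dec_induct)
    case (step i)
    show ?case
    proof (rule ccontr)
      assume "y \<notin> lower_central G (Suc i)"
      then have "commutator G u g \<in> lower_central G (Suc (Suc i))"
        if "u \<in> lower_central G i" "g \<in> carrier G" for u g
        using commutator_mem_of_outside_commuting[OF s subgroup_lower_central card_lower_central_Suc
            lower_central_Suc_subset _ _ _ _ y(2) that] step commutator_M_lower_central[of i] by simp
      then have "lower_central G (Suc i) \<subseteq> lower_central G (Suc (Suc i))"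
        using step.hyps by (subst lower_central_Suc_le_iff[OF subgroup_lower_central]) auto
      then show False using not_lower_central_subset[of "Suc i"] step by simp
    qed
  qed (use y2 in simp)
  then show ?thesis using four_le_m by simp
qed

lemma centralizer_subset_M:
  assumes "x \<in> M" "x \<notin> lower_central G (m - 1)"
  shows "centralizer_mod G {\<one>} {x} \<subseteq> M"
  using commuting_outside_M[OF _ _ assms(1)] assms(2) by (auto simp: centralizer_mod_def)

lemma centralizer_last: "z \<in> lower_central G (m - 1) \<Longrightarrow> centralizer_mod G {\<one>} {z} = carrier G"
  using lower_central_last_central by (auto simp: centralizer_mod_def)

lemma last_subset_M: "lower_central G (m - 1) \<subseteq> M"
proof -
  have "2 \<le> m - 1" using four_le_m by simp
  then show ?thesis using lower_central_antimono lower_central_2_subset_M by blast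
qed

lemma card_last: "card (lower_central G (m - 1)) = p"
  using card_lower_central[of "m - 1"] four_le_m by auto

text \<open>The centralizer meets \<open>M\<close> exactly in
  \<open>\<gamma>\<^sub>m\<^sub>-\<^sub>1\<close>, of order \<open>p\<close>. It is strictly larger
  because it contains \<open>s\<close>, and at most \<open>p\<close> times larger because
  \<open>M\<close> has index \<open>p\<close>. Being cyclic modulo a central subgroup, it is
  abelian.\<close>

lemma centralizer_outside_M:
  assumes s: "s \<in> carrier G" "s \<notin> M"
  shows "card (centralizer_mod G {\<one>} {s}) = p\<^sup>2"
    and "\<And>g h. \<lbrakk>g \<in> centralizer_mod G {\<one>} {s}; h \<in> centralizer_mod G {\<one>} {s}\<rbrakk>
      \<Longrightarrow> commutator G g h = \<one>"
proof -
  let ?C = "centralizer_mod G {\<one>} {s}" and ?Z = "lower_central G (m - 1)"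
  have C: "subgroup ?C G" using s by (simp add: subgroup_centralizer)
  have "?C \<inter> M \<subseteq> ?Z"
    using commuting_outside_M[OF s] commutator_mem_commute[OF triv_subgroup _ s(1)]
    by (auto simp: centralizer_mod_def)
  then have CM: "?C \<inter> M = ?Z"
    using last_subset_M lower_central_last_central s M_subset by (auto simp: centralizer_mod_def)
  have "s \<in> ?C"
    using s by (simp add: centralizer_mod_def)
  then have "?Z \<subset> ?C"
    using CM last_subset_M s(2) by blast
  then have "p * p \<le> card ?C"
    using card_psubset_subgroup[OF C subgroup_lower_central[of "m - 1"]] card_last by simp
  moreover have "card ?C \<le> p * p"
    using card_le_index_times_card_Int[OF _ subgroup_M C order_eq_p_card_M] CM card_last by simp
  ultimately show card: "card ?C = p\<^sup>2" by (simp add: power2_eq_square)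
  show "commutator G g h = \<one>" if gh: "g \<in> ?C" "h \<in> ?C" for g h
  proof -
    have "commutator G g h \<in> {\<one>}"
    proof (rule commutator_mem_of_index_p[OF subgroup_lower_central C one_is_normal _ _ _ gh])
      show "card ?C = p * card ?Z" using card card_last by (simp add: power2_eq_square)
      show "?Z \<subseteq> ?C" using CM by blast
      show "commutator G k h \<in> {\<one>}" if "k \<in> ?Z" "h \<in> ?C" for k h
        using that lower_central_last_central(1) subgroup.mem_carrier[OF C] by simp
    qed
    then show ?thesis by simp
  qed
qed

end

section \<open>Counting commuting tuples\<close>

text \<open>For a subgroup \<open>S\<close> these are its own commuting tuples; restricting the
  entries instead of the group structure keeps all counts inside \<open>G\<close>.\<close>

definition commuting_tuples_in :: "('a, 'b) monoid_scheme \<Rightarrow> 'a set \<Rightarrow> nat \<Rightarrow> 'a list set" where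
  "commuting_tuples_in G S n = {xs \<in> commuting_tuples G n. set xs \<subseteq> S}"

context group
begin

lemma commuting_tuples_in_carrier: "commuting_tuples_in G (carrier G) n = commuting_tuples G n"
  by (auto simp: commuting_tuples_in_def commuting_tuples_def)

lemma commuting_tuples_alt:
  "commuting_tuples G n = {xs. length xs = n \<and> set xs \<subseteq> carrier G \<and>
     (\<forall>x\<in>set xs. \<forall>y\<in>set xs. commutator G x y = \<one>)}"
  unfolding commuting_tuples_def by (auto simp: all_set_conv_all_nth)

lemma finite_commuting_tuples: "finite (carrier G) \<Longrightarrow> finite (commuting_tuples G n)"
  by (rule finite_subset[OF _ finite_lists_length_eq[of "carrier G" n]])
    (auto simp: commuting_tuples_def)

lemma finite_commuting_tuples_in: "finite (carrier G) \<Longrightarrow> finite (commuting_tuples_in G S n)"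
  using finite_commuting_tuples by (simp add: commuting_tuples_in_def)

lemma commuting_tuples_in_0: "commuting_tuples_in G S 0 = {[]}"
  by (auto simp: commuting_tuples_in_def commuting_tuples_def)

lemma commuting_tuples_in_Suc:
  assumes "S \<subseteq> carrier G"
  shows "commuting_tuples_in G S (Suc n) =
    (\<Union>x\<in>S. (#) x ` commuting_tuples_in G (S \<inter> centralizer_mod G {\<one>} {x}) n)"
proof (intro equalityI subsetI)
  fix xs assume xs: "xs \<in> commuting_tuples_in G S (Suc n)"
  then obtain x ys where xs_eq: "xs = x # ys"
    by (cases xs) (auto simp: commuting_tuples_in_def commuting_tuples_def)
  have "x \<in> S" "ys \<in> commuting_tuples_in G (S \<inter> centralizer_mod G {\<one>} {x}) n"
    using xs unfolding xs_eq
    by (auto simp: commuting_tuples_in_def commuting_tuples_alt centralizer_mod_def)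
  then show "xs \<in> (\<Union>x\<in>S. (#) x ` commuting_tuples_in G (S \<inter> centralizer_mod G {\<one>} {x}) n)"
    unfolding xs_eq by blast
next
  fix xs assume "xs \<in> (\<Union>x\<in>S. (#) x ` commuting_tuples_in G (S \<inter> centralizer_mod G {\<one>} {x}) n)"
  then obtain x ys where x: "x \<in> S" "xs = x # ys"
    and ys: "ys \<in> commuting_tuples_in G (S \<inter> centralizer_mod G {\<one>} {x}) n" by blast
  have "commutator G x y = \<one>" "commutator G y x = \<one>" if "y \<in> set ys" for y
    using ys x that assms commutator_mem_commute[OF triv_subgroup, of y x]
    by (auto simp: commuting_tuples_in_def centralizer_mod_def)
  then show "xs \<in> commuting_tuples_in G S (Suc n)"
    using x ys assms by (auto simp: commuting_tuples_in_def commuting_tuples_alt)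
qed

lemma card_commuting_tuples_in_Suc:
  assumes "finite (carrier G)" "S \<subseteq> carrier G"
  shows "card (commuting_tuples_in G S (Suc n)) =
    (\<Sum>x\<in>S. card (commuting_tuples_in G (S \<inter> centralizer_mod G {\<one>} {x}) n))"
proof -
  have "card (commuting_tuples_in G S (Suc n)) =
    (\<Sum>x\<in>S. card ((#) x ` commuting_tuples_in G (S \<inter> centralizer_mod G {\<one>} {x}) n))"
    unfolding commuting_tuples_in_Suc[OF assms(2)]
    using assms finite_commuting_tuples_in
    by (intro card_UN_disjoint) (auto intro: finite_subset)
  then show ?thesis by (simp add: card_image)
qed

lemma card_commuting_tuples_in_commutative:
  assumes "finite (carrier G)" "S \<subseteq> carrier G"
    and comm: "\<And>x y. \<lbrakk>x \<in> S; y \<in> S\<rbrakk> \<Longrightarrow> commutator G x y = \<one>"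
  shows "card (commuting_tuples_in G S n) = card S ^ n"
proof (induction n)
  case (Suc n)
  have "S \<inter> centralizer_mod G {\<one>} {x} = S" if "x \<in> S" for x
    using that comm assms(2) by (auto simp: centralizer_mod_def)
  then show ?case
    using Suc by (simp add: card_commuting_tuples_in_Suc[OF assms(1,2)])
qed (simp add: commuting_tuples_in_0)

section \<open>Burnside's lemma for simultaneous conjugation\<close>

lemma commutator_conj_eq_one_iff:
  assumes "g \<in> carrier G" "x \<in> carrier G" "y \<in> carrier G"
  shows "commutator G (g \<otimes> x \<otimes> inv g) (g \<otimes> y \<otimes> inv g) = \<one> \<longleftrightarrow> commutator G x y = \<one>"
  using normal_conj_iff[OF one_is_normal, of g "commutator G x y"] assms
  by (simp add: conj_commutator)

lemma map_conj_in_commuting_tuples: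
  assumes "g \<in> carrier G" "xs \<in> commuting_tuples G n"
  shows "map (\<lambda>x. g \<otimes> x \<otimes> inv g) xs \<in> commuting_tuples G n"
  using assms by (auto simp: commuting_tuples_alt commutator_conj_eq_one_iff subset_iff)

lemma map_conj_map_conj:
  assumes "g \<in> carrier G" "h \<in> carrier G" "xs \<in> commuting_tuples G n"
  shows "map (\<lambda>x. g \<otimes> x \<otimes> inv g) (map (\<lambda>x. h \<otimes> x \<otimes> inv h) xs)
    = map (\<lambda>x. (g \<otimes> h) \<otimes> x \<otimes> inv (g \<otimes> h)) xs"
  using assms by (auto simp: commuting_tuples_def inv_mult_group m_assoc subset_iff)

lemma map_conj_one:
  assumes "xs \<in> commuting_tuples G n"
  shows "map (\<lambda>x. \<one> \<otimes> x \<otimes> inv \<one>) xs = xs"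
  using assms by (intro map_idI) (auto simp: commuting_tuples_def subset_iff)

lemma group_action_simultaneous_conj:
  "group_action G (commuting_tuples G n) (simultaneous_conj G n)"
proof -
  let ?E = "commuting_tuples G n"
  have bij: "simultaneous_conj G n g \<in> Bij ?E" if g: "g \<in> carrier G" for g
  proof -
    have "bij_betw (simultaneous_conj G n g) ?E ?E"
    proof (rule bij_betwI[where g = "simultaneous_conj G n (inv g)"])
      show "simultaneous_conj G n (inv g) (simultaneous_conj G n g xs) = xs" if "xs \<in> ?E" for xs
        using that g map_conj_map_conj[of "inv g" g xs n] map_conj_one[of xs n] map_conj_in_commuting_tuples
        by (simp add: simultaneous_conj_def del: map_map)
      show "simultaneous_conj G n g (simultaneous_conj G n (inv g) xs) = xs" if "xs \<in> ?E" for xs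
        using that g map_conj_map_conj[of g "inv g" xs n] map_conj_one[of xs n]
          map_conj_in_commuting_tuples[of "inv g"]
        by (simp add: simultaneous_conj_def del: map_map)
    qed (use g map_conj_in_commuting_tuples[of g _ n] map_conj_in_commuting_tuples[of "inv g" _ n] in \<open>auto simp: simultaneous_conj_def simp del: map_map\<close>)
    then show ?thesis by (simp add: Bij_def simultaneous_conj_def)
  qed
  have "simultaneous_conj G n (g \<otimes> h) = compose ?E (simultaneous_conj G n g) (simultaneous_conj G n h)"
    if "g \<in> carrier G" "h \<in> carrier G" for g h
    using that map_conj_map_conj[OF that] map_conj_in_commuting_tuples[OF that(2)]
    unfolding simultaneous_conj_def compose_def
    by (intro restrict_ext) (simp del: map_map)
  then have "simultaneous_conj G n \<in> hom G (BijGroup ?E)"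
    using bij by (auto simp: hom_def BijGroup_def)
  then show ?thesis
    unfolding group_action_def group_hom_def group_hom_axioms_def
    using group_BijGroup is_group by blast
qed

text \<open>The tuples fixed by \<open>g\<close> are those with all entries in the centralizer of
  \<open>g\<close>, that is, the tails of the commuting \<open>(n + 1)\<close>-tuples starting with
  \<open>g\<close>. Summing over \<open>g\<close> turns Burnside's count into the number of longer
  tuples.\<close>

lemma order_mult_commuting_orbit_count:
  assumes "finite (carrier G)"
  shows "order G * commuting_orbit_count G n = card (commuting_tuples G (Suc n))"
proof -
  interpret action: group_action G "commuting_tuples G n" "simultaneous_conj G n"
    by (rule group_action_simultaneous_conj)
  have "invariants (commuting_tuples G n) (simultaneous_conj G n) g
      = commuting_tuples_in G (carrier G \<inter> centralizer_mod G {\<one>} {g}) n" if g: "g \<in> carrier G" for g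
  proof -
    have fix_iff: "g \<otimes> x \<otimes> inv g = x \<longleftrightarrow> commutator G x g = \<one>" if "x \<in> carrier G" for x
      using that g by (auto simp: commutator_eq_one_iff inv_solve_right')
    have "map (\<lambda>x. g \<otimes> x \<otimes> inv g) xs = xs \<longleftrightarrow> set xs \<subseteq> centralizer_mod G {\<one>} {g}"
      if "set xs \<subseteq> carrier G" for xs
    proof -
      have "map (\<lambda>x. g \<otimes> x \<otimes> inv g) xs = xs \<longleftrightarrow> (\<forall>x\<in>set xs. g \<otimes> x \<otimes> inv g = x)"
        by (induction xs) auto
      also have "\<dots> \<longleftrightarrow> set xs \<subseteq> centralizer_mod G {\<one>} {g}"
        using that fix_iff by (auto simp: centralizer_mod_def)
      finally show ?thesis .
    qed
    then show ?thesis
      by (auto simp: invariants_def simultaneous_conj_def commuting_tuples_in_def commuting_tuples_def)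
  qed
  then have "(\<Sum>g\<in>carrier G. card (invariants (commuting_tuples G n) (simultaneous_conj G n) g))
      = card (commuting_tuples_in G (carrier G) (Suc n))"
    using assms by (simp add: card_commuting_tuples_in_Suc)
  then show ?thesis
    using action.burnside[OF assms finite_commuting_tuples[OF assms]]
    by (simp add: commuting_orbit_count_def commuting_tuples_in_carrier mult.commute)
qed

end

section \<open>Recurrences for the number of commuting tuples\<close>

context maximal_class_group_uniform
begin

text \<open>The first entry ranges over three layers: the centre, with centralizer \<open>G\<close>;
  the rest of \<open>M\<close>, whose contribution depends on the case; and \<open>G - M\<close>,
  with abelian centralizers of order \<open>p\<^sup>2\<close>.\<close>

lemma card_commuting_tuples_Suc:
  "card (commuting_tuples G (Suc n)) =
     p * card (commuting_tuples G n)
     + (\<Sum>x\<in>M - lower_central G (m - 1). card (commuting_tuples_in G (centralizer_mod G {\<one>} {x}) n))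
     + (p ^ m - p ^ (m - 1)) * p ^ (2 * n)"
proof -
  let ?Z = "lower_central G (m - 1)"
  let ?c = "\<lambda>x. card (commuting_tuples_in G (centralizer_mod G {\<one>} {x}) n)"
  have "card (commuting_tuples G (Suc n)) = (\<Sum>x\<in>carrier G. ?c x)"
    using card_commuting_tuples_in_Suc[of "carrier G" n] centralizer_mod_subset[of "{\<one>}"]
    by (simp add: commuting_tuples_in_carrier Int_absorb1)
  also have "\<dots> = (\<Sum>x\<in>carrier G - M. ?c x) + ((\<Sum>x\<in>M - ?Z. ?c x) + (\<Sum>x\<in>?Z. ?c x))"
    using sum.subset_diff[OF M_subset, of ?c] sum.subset_diff[OF last_subset_M, of ?c]
      finite_subgroup[OF subgroup_M] by simp
  also have "(\<Sum>x\<in>?Z. ?c x) = p * card (commuting_tuples G n)"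
    using centralizer_last card_last by (simp add: commuting_tuples_in_carrier)
  also have "(\<Sum>x\<in>carrier G - M. ?c x) = (p ^ m - p ^ (m - 1)) * p ^ (2 * n)"
  proof -
    have "?c s = p ^ (2 * n)" if "s \<in> carrier G - M" for s
    proof -
      have "?c s = card (centralizer_mod G {\<one>} {s}) ^ n"
        using that centralizer_outside_M(2)[of s]
        by (intro card_commuting_tuples_in_commutative centralizer_mod_subset) auto
      then show ?thesis using centralizer_outside_M(1)[of s] that by (simp add: power_mult)
    qed
    moreover have "card (carrier G - M) = p ^ m - p ^ (m - 1)"
      using card_Diff_subset[OF finite_subgroup[OF subgroup_M] M_subset] order_eq card_M
      by (simp add: order_def)
    ultimately show ?thesis by simp
  qed
  finally show ?thesis by simp
qed

end

lemma (in group) abelian_subgroup_iff: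
  "abelian_subgroup G H \<longleftrightarrow> subgroup H G \<and> (\<forall>x\<in>H. \<forall>y\<in>H. commutator G x y = \<one>)"
proof (cases "subgroup H G")
  case True
  interpret H: group "G\<lparr>carrier := H\<rparr>"
    using subgroup.subgroup_is_group[OF True is_group] .
  have "comm_group (G\<lparr>carrier := H\<rparr>) \<longleftrightarrow> (\<forall>x\<in>H. \<forall>y\<in>H. x \<otimes> y = y \<otimes> x)"
  proof
    assume "comm_group (G\<lparr>carrier := H\<rparr>)"
    then show "\<forall>x\<in>H. \<forall>y\<in>H. x \<otimes> y = y \<otimes> x"
      using comm_groupE(4) by fastforce
  qed (auto intro!: H.group_comm_groupI)
  then show ?thesis
    using True subgroup.mem_carrier[OF True]
    by (simp add: abelian_subgroup_def commutator_eq_one_iff)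
qed (simp add: abelian_subgroup_def)

context finite_p_group
begin

lemma maximal_subgroup_of_index_p:
  assumes "subgroup M G" "order G = p * card M"
  shows "maximal_subgroup G M"
  unfolding maximal_subgroup_def
proof (intro conjI allI impI)
  show "M \<noteq> carrier G"
    using assms card_subgroup_pos[OF assms(1)] p_gt_1 by (auto simp: order_def)
  show "K = M \<or> K = carrier G" if "subgroup K G" "M \<subseteq> K" for K
  proof (rule disjCI)
    assume "K \<noteq> carrier G"
    show "K = M"
    proof (rule ccontr)
      assume "K \<noteq> M"
      then obtain y where "y \<in> K" "y \<notin> M" using \<open>M \<subseteq> K\<close> by blast
      then have "K = carrier G"
        using assms that subgroup.subset[OF that(1)]
        by (intro subgroup_index_p_maximal[OF assms(1) subgroup_self]) (auto simp: order_def)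
      then show False using \<open>K \<noteq> carrier G\<close> by contradiction
    qed
  qed
qed (fact assms)

end

context maximal_class_group
begin

text \<open>Otherwise every subgroup containing both \<open>A\<close> and
  \<open>\<gamma>\<^sub>2\<close> is \<open>G\<close>. The centralizer of \<open>h\<close> modulo
  \<open>\<gamma>\<^sub>3\<close> always contains \<open>\<gamma>\<^sub>2\<close>, so it suffices
  that it contains \<open>A\<close>: this holds first for \<open>h\<close> in \<open>A\<close>, then
  for all \<open>h\<close>, making \<open>G/\<gamma>\<^sub>3\<close> abelian.\<close>

lemma lower_central_2_subset_abelian_maximal:
  assumes A: "maximal_subgroup G A" and comm: "\<And>x y. \<lbrakk>x \<in> A; y \<in> A\<rbrakk> \<Longrightarrow> commutator G x y = \<one>"
  shows "lower_central G 2 \<subseteq> A"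
proof (rule ccontr)
  assume nsub: "\<not> lower_central G 2 \<subseteq> A"
  have SA: "subgroup A G" using A by (simp add: maximal_subgroup_def)
  have full: "centralizer_mod G (lower_central G 3) {h} = carrier G"
    if h: "h \<in> carrier G" and Ah: "\<And>x. x \<in> A \<Longrightarrow> commutator G x h \<in> lower_central G 3" for h
  proof -
    let ?D = "centralizer_mod G (lower_central G 3) {h}"
    have "subgroup ?D G"
      using h by (intro subgroup_centralizer_mod normal_lower_central) auto
    moreover have "A \<subseteq> ?D"
      using Ah subgroup.mem_carrier[OF SA] by (auto simp: centralizer_mod_def)
    moreover have "lower_central G 2 \<subseteq> ?D"
      using h lower_central_subset commutator_in_lower_central(1)[of _ 2 h]
      by (auto simp: centralizer_mod_def)
    ultimately show ?thesis
      using A nsub by (auto simp: maximal_subgroup_def)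
  qed
  have AG: "commutator G g h \<in> lower_central G 3" if "g \<in> carrier G" "h \<in> A" for g h
  proof -
    have "centralizer_mod G (lower_central G 3) {h} = carrier G"
      using that comm subgroup.mem_carrier[OF SA] subgroup.one_closed[OF subgroup_lower_central]
      by (intro full) auto
    then show ?thesis using that by (auto simp: centralizer_mod_def)
  qed
  \<comment> \<open>\<open>AG\<close> with its commutator inverted says that \<open>A\<close>
    centralizes every \<open>h\<close> modulo \<open>\<gamma>\<^sub>3\<close>, which is the
    hypothesis of \<open>full\<close>.\<close>
  have "commutator G g h \<in> lower_central G 3" if "g \<in> carrier G" "h \<in> carrier G" for g h
  proof -
    have "centralizer_mod G (lower_central G 3) {h} = carrier G"
      using that AG[of h] subgroup.mem_carrier[OF SA]
        commutator_mem_commute[OF subgroup_lower_central that(2)]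
      by (intro full) auto
    then show ?thesis using that by (auto simp: centralizer_mod_def)
  qed
  then have "lower_central G 2 \<subseteq> lower_central G 3"
    using lower_central_Suc_le_iff[OF subgroup_lower_central, of 1 3] by (simp add: numeral_2_eq_2)
  then show False
    using not_lower_central_subset[of 2] four_le_m by simp
qed

text \<open>Since \<open>\<gamma>\<^sub>2\<close> has index \<open>p\<^sup>2\<close>, a subgroup
  strictly between it and \<open>G\<close> has index \<open>p\<close>. The case
  \<open>A = \<gamma>\<^sub>2\<close> is excluded because the 2-step centralizer lies strictly
  between \<open>\<gamma>\<^sub>2\<close> and \<open>G\<close>.\<close>

lemma card_maximal_subgroup:
  assumes A: "maximal_subgroup G A" and sub: "lower_central G 2 \<subseteq> A"
  shows "card A = p ^ (m - 1)"
proof -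
  let ?M = "two_step_centralizer G 2"
  have SA: "subgroup A G" using A by (simp add: maximal_subgroup_def)
  have "A \<subset> carrier G"
    using A subgroup.subset[OF SA] by (auto simp: maximal_subgroup_def)
  then have "p * card A \<le> p ^ m"
    using card_psubset_subgroup[OF subgroup_self SA] order_eq by (simp add: order_def)
  then have upper: "card A \<le> p ^ (m - 1)"
    using p_gt_1 four_le_m by (cases m) auto
  have "lower_central G 2 \<noteq> A"
  proof
    assume "lower_central G 2 = A"
    moreover have "?M \<noteq> carrier G"
      using maximal_subgroup_of_index_p[OF subgroup_two_step_centralizer
          order_eq_card_two_step_centralizer_2] by (simp add: maximal_subgroup_def)
    ultimately have "?M = lower_central G 2"
      using A lower_central_2_subset_two_step_centralizer subgroup_two_step_centralizer
      by (auto simp: maximal_subgroup_def)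
    then have "p ^ (m - 1) = p ^ (m - 2)"
      using card_two_step_centralizer_2 card_lower_central[of 2] four_le_m by simp
    then have "m - 1 = m - 2" using power_inject_exp[OF p_gt_1] by blast
    then show False using four_le_m by simp
  qed
  then have "p * p ^ (m - 2) \<le> card A"
    using card_psubset_subgroup[OF SA subgroup_lower_central[of 2]] sub card_lower_central[of 2] four_le_m
    by auto
  moreover have "p * p ^ (m - 2) = p ^ (m - 1)"
    using four_le_m by (simp flip: power_Suc add: Suc_diff_le numeral_2_eq_2 Suc_diff_Suc)
  ultimately show ?thesis using upper by simp
qed

text \<open>A non-central element of the abelian subgroup \<open>A\<close> has centralizer exactly
  \<open>A\<close>, so the middle layer contributes powers of \<open>card A\<close>.\<close>

lemma card_commuting_tuples_Suc_abelian_maximal: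
  assumes "has_abelian_maximal_subgroup G"
  shows "card (commuting_tuples G (Suc n)) = p * card (commuting_tuples G n)
    + (p ^ (m - 1) - p) * p ^ ((m - 1) * n) + (p ^ m - p ^ (m - 1)) * p ^ (2 * n)"
proof -
  obtain A where A: "maximal_subgroup G A" and "abelian_subgroup G A"
    using assms by (auto simp: has_abelian_maximal_subgroup_def)
  then have SA: "subgroup A G" and comm: "\<And>x y. \<lbrakk>x \<in> A; y \<in> A\<rbrakk> \<Longrightarrow> commutator G x y = \<one>"
    by (auto simp: abelian_subgroup_iff)
  have sub: "lower_central G 2 \<subseteq> A"
    using lower_central_2_subset_abelian_maximal[OF A] comm by blast
  interpret maximal_class_group_uniform G p m A
  proof (intro maximal_class_group_uniform.intro maximal_class_group_axioms
      maximal_class_group_uniform_axioms.intro)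
    show "commutator G x y \<in> lower_central G (i + 2)"
      if "2 \<le> i" "x \<in> A" "y \<in> lower_central G i" for i x y
      using that comm[of x y] sub lower_central_antimono[of 2 i]
        subgroup.one_closed[OF subgroup_lower_central] by auto
  qed (fact SA sub card_maximal_subgroup[OF A sub])+
  let ?Z = "lower_central G (m - 1)"
  have "card (commuting_tuples_in G (centralizer_mod G {\<one>} {x}) n) = p ^ ((m - 1) * n)"
    if x: "x \<in> A - ?Z" for x
  proof -
    have "centralizer_mod G {\<one>} {x} = A"
      using centralizer_subset_M[of x] x comm M_subset by (auto simp: centralizer_mod_def)
    then show ?thesis
      using card_commuting_tuples_in_commutative[OF _ M_subset, of n] comm card_M by (simp add: power_mult)
  qed
  moreover have "card (A - ?Z) = p ^ (m - 1) - p"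
    using card_Diff_subset[OF finite_subgroup[OF subgroup_lower_central] last_subset_M] card_M card_last
    by simp
  ultimately show ?thesis
    by (simp add: card_commuting_tuples_Suc)
qed

text \<open>Elements of \<open>\<gamma>\<^sub>3\<close> outside the centre of \<open>G\<close> have
  centralizer \<open>P\<^sub>1\<close>, which is not abelian, so the recurrence for \<open>G\<close>
  involves the count \<open>d\<close> for \<open>P\<^sub>1\<close> and needs a second recurrence for
  \<open>d\<close> itself.\<close>

lemma card_commuting_tuples_Suc_two_step:
  assumes no_abel: "\<not> has_abelian_maximal_subgroup G"
    and comm3: "\<And>x y. \<lbrakk>x \<in> two_step_centralizer G 2; y \<in> lower_central G 3\<rbrakk> \<Longrightarrow> commutator G x y = \<one>"
  defines "d \<equiv> \<lambda>n. card (commuting_tuples_in G (two_step_centralizer G 2) n)"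
  shows "card (commuting_tuples G (Suc n)) = p * card (commuting_tuples G n)
      + (p ^ (m - 3) - p) * d n + (p ^ (m - 1) - p ^ (m - 3)) * p ^ ((m - 2) * n)
      + (p ^ m - p ^ (m - 1)) * p ^ (2 * n)"
    and "d (Suc n) = p ^ (m - 3) * d n + (p ^ (m - 1) - p ^ (m - 3)) * p ^ ((m - 2) * n)"
proof -
  define M where "M = two_step_centralizer G 2"
  let ?Z = "lower_central G (m - 1)"
  let ?C = "\<lambda>x. centralizer_mod G {\<one>} {x}"
  have comm: "commutator G x y = \<one>" if "x \<in> M" "y \<in> lower_central G 3" for x y
    using comm3 that by (simp add: M_def)
  interpret maximal_class_group_uniform G p m M
  proof (intro maximal_class_group_uniform.intro maximal_class_group_axioms
      maximal_class_group_uniform_axioms.intro)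
    show "commutator G x y \<in> lower_central G (i + 2)"
      if "2 \<le> i" "x \<in> M" "y \<in> lower_central G i" for i x y
    proof (cases "i = 2")
      case True
      then show ?thesis using that by (auto simp: M_def two_step_centralizer_def)
    next
      case False
      then have "y \<in> lower_central G 3" using that lower_central_antimono[of 3 i] by auto
      then show ?thesis using comm that subgroup.one_closed[OF subgroup_lower_central] by simp
    qed
  qed (simp_all add: M_def subgroup_two_step_centralizer card_two_step_centralizer_2
      lower_central_2_subset_two_step_centralizer)
  have comm': "commutator G y x = \<one>" if "x \<in> M" "y \<in> lower_central G 3" for x y
    using commutator_mem_commute[OF triv_subgroup, of x y] comm[OF that] that M_subset
      lower_central_subset by auto
  have Z3: "?Z \<subseteq> lower_central G 3"
    using four_le_m by (intro lower_central_antimono) simp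
  have M3: "lower_central G 3 \<subseteq> M"
    using lower_central_antimono[of 2 3] lower_central_2_subset_M by auto
  have card3: "card (lower_central G 3) = p ^ (m - 3)"
    using card_lower_central[of 3] four_le_m by simp
  have p_powers: "p * p ^ (m - 3) = p ^ (m - 2)" "p * p ^ (m - 2) = p ^ (m - 1)"
    using four_le_m by (auto simp flip: power_Suc intro!: arg_cong[of _ _ "(^) p"])
  \<comment> \<open>\<open>M\<close> has order \<open>p\<^sup>2\<close> times that of
    \<open>\<gamma>\<^sub>3\<close>, so a subgroup strictly in between has order
    \<open>p ^ (m - 2)\<close>.\<close>
  have squeeze: "k = p ^ (m - 2)" if "p * p ^ (m - 3) \<le> k" "p * k \<le> p ^ (m - 1)" for k
    using that p_gt_1 unfolding p_powers(1) p_powers(2)[symmetric] by simp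
  \<comment> \<open>\<open>M\<close> has index \<open>p\<close>, hence is a maximal
    subgroup.\<close>
  have nonabelian: "\<not> (\<forall>x\<in>M. \<forall>y\<in>M. commutator G x y = \<one>)"
    using no_abel maximal_subgroup_of_index_p[OF subgroup_M order_eq_p_card_M] subgroup_M
    by (auto simp: has_abelian_maximal_subgroup_def abelian_subgroup_iff)
  have outside3: "?C x \<subseteq> M" "card (?C x) = p ^ (m - 2)"
    "\<And>g h. \<lbrakk>g \<in> ?C x; h \<in> ?C x\<rbrakk> \<Longrightarrow> commutator G g h = \<one>"
    if x: "x \<in> M - lower_central G 3" for x
  proof -
    have xc: "x \<in> carrier G" using x M_subset by auto
    have C: "subgroup (?C x) G" using xc by (rule subgroup_centralizer)
    show CM: "?C x \<subseteq> M" using centralizer_subset_M[of x] x Z3 by auto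
    have xC: "x \<in> ?C x" using xc by (simp add: centralizer_mod_def)
    have C3: "lower_central G 3 \<subseteq> ?C x"
      using comm' x lower_central_subset by (auto simp: centralizer_mod_def)
    have "?C x \<noteq> M"
    proof
      assume "?C x = M"
      \<comment> \<open>\<open>?W\<close> is the centre of \<open>M\<close>. It would contain
        \<open>x\<close> besides \<open>\<gamma>\<^sub>3\<close>, and so have index \<open>p\<close>
        in \<open>M\<close>; then \<open>M\<close> would be abelian.\<close>
      let ?W = "M \<inter> centralizer_mod G {\<one>} M"
      have W: "subgroup ?W G"
        by (intro subgroups_Inter_pair subgroup_M subgroup_centralizer_mod one_is_normal M_subset)
      have "x \<in> ?W"
        using \<open>?C x = M\<close> x xc M_subset commutator_mem_commute[OF triv_subgroup _ xc]
        by (auto simp: centralizer_mod_def)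
      moreover have "lower_central G 3 \<subseteq> ?W"
        using M3 M_subset comm' by (auto simp: centralizer_mod_def)
      ultimately have "p * card (lower_central G 3) \<le> card ?W"
        using x by (intro card_psubset_subgroup W subgroup_lower_central) auto
      moreover have "?W \<noteq> M" using nonabelian by (auto simp: centralizer_mod_def)
      then have "p * card ?W \<le> card M"
        by (intro card_psubset_subgroup W subgroup_M) auto
      ultimately have "card M = p * card ?W"
        using squeeze[of "card ?W"] card3 card_M p_powers by simp
      then have "commutator G g h \<in> {\<one>}" if "g \<in> M" "h \<in> M" for g h
        by (rule commutator_mem_of_index_p[OF W subgroup_M one_is_normal _ _ _ that])
          (auto simp: centralizer_mod_def)
      then show False using nonabelian by auto
    qed
    then have "p * card (?C x) \<le> card M"
      using CM by (intro card_psubset_subgroup C subgroup_M) auto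
    moreover have "p * card (lower_central G 3) \<le> card (?C x)"
      using x xC C3 by (intro card_psubset_subgroup C subgroup_lower_central) auto
    ultimately show card: "card (?C x) = p ^ (m - 2)"
      using squeeze[of "card (?C x)"] card3 card_M by simp
    \<comment> \<open>\<open>\<gamma>\<^sub>3\<close> is central in the centralizer of
      \<open>x\<close> and has index \<open>p\<close> in it.\<close>
    show "commutator G g h = \<one>" if gh: "g \<in> ?C x" "h \<in> ?C x" for g h
    proof -
      have "commutator G g h \<in> {\<one>}"
      proof (rule commutator_mem_of_index_p[OF subgroup_lower_central C one_is_normal _ C3 _ gh])
        show "card (?C x) = p * card (lower_central G 3)" using card card3 p_powers by simp
        show "commutator G k h \<in> {\<one>}" if "k \<in> lower_central G 3" "h \<in> ?C x" for k h
          using that CM comm' by auto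
      qed
      then show ?thesis by simp
    qed
  qed
  have count_outside3: "(\<Sum>x\<in>M - lower_central G 3. card (commuting_tuples_in G (?C x) n))
      = (p ^ (m - 1) - p ^ (m - 3)) * p ^ ((m - 2) * n)" for n
  proof -
    have "card (commuting_tuples_in G (?C x) n) = p ^ ((m - 2) * n)"
      if x: "x \<in> M - lower_central G 3" for x
    proof -
      have "card (commuting_tuples_in G (?C x) n) = card (?C x) ^ n"
        using outside3[OF x] by (intro card_commuting_tuples_in_commutative centralizer_mod_subset) auto
      then show ?thesis using outside3[OF x] by (simp add: power_mult)
    qed
    moreover have "card (M - lower_central G 3) = p ^ (m - 1) - p ^ (m - 3)"
      using card_Diff_subset[OF finite_subgroup[OF subgroup_lower_central] M3] card_M card3 by simp
    ultimately show ?thesis by simp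
  qed
  have M_le_C: "M \<subseteq> ?C x" if "x \<in> lower_central G 3" for x
    using that comm M_subset by (auto simp: centralizer_mod_def)
  have d: "d = (\<lambda>n. card (commuting_tuples_in G M n))" by (simp add: d_def M_def)
  have "(\<Sum>x\<in>M - ?Z. card (commuting_tuples_in G (?C x) n))
      = (\<Sum>x\<in>M - lower_central G 3. card (commuting_tuples_in G (?C x) n))
        + (\<Sum>x\<in>lower_central G 3 - ?Z. card (commuting_tuples_in G (?C x) n))"
  proof -
    have "M - ?Z = (M - lower_central G 3) \<union> (lower_central G 3 - ?Z)" using Z3 M3 by auto
    then show ?thesis
      using finite_subgroup[OF subgroup_M] finite_subgroup[OF subgroup_lower_central]
      by (simp only:) (intro sum.union_disjoint, auto)
  qed
  \<comment> \<open>For \<open>m = 4\<close> this layer is empty and the coefficient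
    \<open>p ^ (m - 3) - p\<close> vanishes.\<close>
  also have "(\<Sum>x\<in>lower_central G 3 - ?Z. card (commuting_tuples_in G (?C x) n))
      = (p ^ (m - 3) - p) * d n"
  proof -
    have "?C x = M" if "x \<in> lower_central G 3 - ?Z" for x
      using that M_le_C[of x] centralizer_subset_M[of x] M3 by auto
    moreover have "card (lower_central G 3 - ?Z) = p ^ (m - 3) - p"
      using card_Diff_subset[OF finite_subgroup[OF subgroup_lower_central] Z3] card_last card3 by simp
    ultimately show ?thesis by (simp add: d)
  qed
  finally show "card (commuting_tuples G (Suc n)) = p * card (commuting_tuples G n)
      + (p ^ (m - 3) - p) * d n + (p ^ (m - 1) - p ^ (m - 3)) * p ^ ((m - 2) * n)
      + (p ^ m - p ^ (m - 1)) * p ^ (2 * n)"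
    unfolding card_commuting_tuples_Suc count_outside3 by simp
  \<comment> \<open>Inside \<open>M\<close> all of \<open>\<gamma>\<^sub>3\<close> is central, so
    only two layers occur.\<close>
  have "d (Suc n) = (\<Sum>x\<in>M. card (commuting_tuples_in G (M \<inter> ?C x) n))"
    unfolding d using M_subset by (simp add: card_commuting_tuples_in_Suc)
  also have "\<dots> = (\<Sum>x\<in>M - lower_central G 3. card (commuting_tuples_in G (M \<inter> ?C x) n))
      + (\<Sum>x\<in>lower_central G 3. card (commuting_tuples_in G (M \<inter> ?C x) n))"
    using M3 finite_subgroup[OF subgroup_M] by (rule sum.subset_diff)
  also have "(\<Sum>x\<in>M - lower_central G 3. card (commuting_tuples_in G (M \<inter> ?C x) n))
      = (p ^ (m - 1) - p ^ (m - 3)) * p ^ ((m - 2) * n)"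
    unfolding count_outside3[symmetric] using outside3(1) by (intro sum.cong) (auto simp: Int_absorb1)
  also have "(\<Sum>x\<in>lower_central G 3. card (commuting_tuples_in G (M \<inter> ?C x) n)) = p ^ (m - 3) * d n"
    using M_le_C card3 by (simp add: Int_absorb2 d)
  finally show "d (Suc n) = p ^ (m - 3) * d n + (p ^ (m - 1) - p ^ (m - 3)) * p ^ ((m - 2) * n)"
    by simp
qed

end

lemma maximal_class_group_of_maximal_class:
  assumes "prime p" "maximal_class G p m"
  shows "maximal_class_group G p m"
proof -
  interpret group G using assms by (simp add: maximal_class_def)
  show ?thesis
  proof
    show "lower_central G i = {\<one>\<^bsub>G\<^esub>} \<longleftrightarrow> m \<le> i" if "1 \<le> i" for i
    proof
      assume "lower_central G i = {\<one>\<^bsub>G\<^esub>}"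
      then have "nilpotency_class G \<le> i - 1"
        unfolding nilpotency_class_def using that by (intro Least_le) simp
      then show "m \<le> i" using assms that by (simp add: maximal_class_def)
    next
      assume "m \<le> i"
      have "lower_central G (Suc (nilpotency_class G)) = {\<one>\<^bsub>G\<^esub>}"
      proof -
        \<comment> \<open>Nilpotency provides a witness, so that the \<open>LEAST\<close> in
          \<open>nilpotency_class\<close> is attained.\<close>
        obtain c where "lower_central G (Suc c) = {\<one>\<^bsub>G\<^esub>}"
          using assms unfolding maximal_class_def nilpotent_group_def by blast
        then show ?thesis unfolding nilpotency_class_def by (rule LeastI)
      qed
      then have "lower_central G m = {\<one>\<^bsub>G\<^esub>}" using assms by (simp add: maximal_class_def)
      then show "lower_central G i = {\<one>\<^bsub>G\<^esub>}"
        using lower_central_antimono[OF \<open>m \<le> i\<close>] subgroup.one_closed[OF subgroup_lower_central] by auto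
    qed
  qed (use assms in \<open>auto simp: maximal_class_def\<close>)
qed

section \<open>Generating functions\<close>

lemma fps_nth_mult_one_minus_const_X:
  "fps_nth ((1 - fps_const r * fps_X) * f) n
    = fps_nth f n - (if n = 0 then 0 else (r :: 'c :: field) * fps_nth f (n - 1))"
  by (simp add: left_diff_distrib mult.assoc)

lemma fps_geometric:
  "1 / (1 - fps_const r * fps_X) = Abs_fps (\<lambda>n. (r :: 'c :: field) ^ n)"
proof -
  have "(1 - fps_const r * fps_X) * Abs_fps (\<lambda>n. r ^ n) = 1"
  proof (rule fps_ext)
    show "fps_nth ((1 - fps_const r * fps_X) * Abs_fps (\<lambda>n. r ^ n)) n = fps_nth 1 n" for n
      unfolding fps_nth_mult_one_minus_const_X by (cases n) auto
  qed
  then show ?thesis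
    by (simp add: fps_divide_unit fps_inverse_unique)
qed

text \<open>The summands of the target of this shape encode geometric inhomogeneities; the factor
  \<open>fps_X\<close> is the shift from \<open>n\<close> to \<open>Suc n\<close>.\<close>

lemma fps_X_divide_geometric:
  "fps_const a * fps_X / (1 - fps_const r * fps_X) = fps_X * Abs_fps (\<lambda>n. a * (r :: 'c :: field) ^ n)"
proof -
  have "fps_const a * fps_X / (1 - fps_const r * fps_X)
      = fps_const a * fps_X * (1 / (1 - fps_const r * fps_X))"
    by (simp add: fps_divide_unit)
  also have "\<dots> = fps_X * (fps_const a * Abs_fps (\<lambda>n. r ^ n))"
    unfolding fps_geometric by (simp only: mult_ac)
  also have "fps_const a * Abs_fps (\<lambda>n. r ^ n) = Abs_fps (\<lambda>n. a * r ^ n)"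
    by (simp add: fps_eq_iff)
  finally show ?thesis .
qed

lemma fps_linear_recurrence:
  fixes b c :: "nat \<Rightarrow> 'c :: field"
  assumes "b 0 = 1" and "\<And>n. b (Suc n) = r * b n + c n"
  shows "Abs_fps b = 1 / (1 - fps_const r * fps_X) * (1 + fps_X * Abs_fps c)"
proof -
  have "(1 - fps_const r * fps_X) * Abs_fps b = 1 + fps_X * Abs_fps c"
  proof (rule fps_ext)
    show "fps_nth ((1 - fps_const r * fps_X) * Abs_fps b) n = fps_nth (1 + fps_X * Abs_fps c) n" for n
      unfolding fps_nth_mult_one_minus_const_X using assms by (cases n) auto
  qed
  then have "1 / (1 - fps_const r * fps_X) * (1 + fps_X * Abs_fps c)
      = (1 / (1 - fps_const r * fps_X) * (1 - fps_const r * fps_X)) * Abs_fps b"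
    by (simp only: mult.assoc)
  also have "1 / (1 - fps_const r * fps_X) * (1 - fps_const r * fps_X) = 1"
    by (simp add: fps_divide_unit inverse_mult_eq_1)
  finally show ?thesis by simp
qed

text \<open>The coefficient \<open>s - t\<close> is such that \<open>1 - s X + (s - t) X\<close>
  collapses to the numerator \<open>1 - t X\<close>.\<close>

lemma fps_linear_recurrence_geometric:
  fixes e :: "nat \<Rightarrow> 'c :: field"
  assumes "e 0 = 1" and "\<And>n. e (Suc n) = r * e n + (s - t) * s ^ n"
  shows "fps_X * Abs_fps e = fps_X * (1 - fps_const t * fps_X)
    / ((1 - fps_const s * fps_X) * (1 - fps_const r * fps_X))"
proof -
  let ?S = "1 - fps_const s * fps_X" and ?R = "1 - fps_const r * fps_X"
  have "Abs_fps e = 1 / ?R * (1 + fps_const (s - t) * fps_X / ?S)"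
    unfolding fps_X_divide_geometric by (rule fps_linear_recurrence) (use assms in auto)
  also have "1 + fps_const (s - t) * fps_X / ?S = (?S + fps_const (s - t) * fps_X) * inverse ?S"
  proof -
    have "?S * inverse ?S = 1" by (simp add: inverse_mult_eq_1')
    moreover have "fps_const (s - t) * fps_X / ?S = fps_const (s - t) * fps_X * inverse ?S"
      by (simp add: fps_divide_unit)
    ultimately show ?thesis by (simp only: distrib_right)
  qed
  also have "?S + fps_const (s - t) * fps_X = 1 - fps_const t * fps_X"
    by (simp add: algebra_simps flip: fps_const_sub)
  finally show ?thesis
    by (simp add: fps_divide_unit fps_inverse_mult mult_ac)
qed

lemma fps_pow_of_nat: "fps_pow p (int k) = fps_const (of_nat p ^ k)"
  by (simp add: fps_pow_def)

lemma fps_pow_of_nat_diff: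
  assumes "j \<le> m"
  shows "fps_pow p (int m - int j) = fps_const (of_nat p ^ (m - j))"
  using assms by (simp add: fps_pow_of_nat flip: of_nat_diff)

text \<open>This isolates the prefactor shared by both formulas; each case then only has to identify
  the inhomogeneity \<open>c\<close>.\<close>

lemma commuting_orbit_fps_eq:
  assumes "group G" and "\<And>n. of_nat (commuting_orbit_count G (Suc n))
    = (of_nat q :: rat) * of_nat (commuting_orbit_count G n) + c n"
  shows "commuting_orbit_fps G = 1 / (1 - fps_pow q 1 * fps_X) * (1 + fps_X * Abs_fps c)"
proof -
  have "Abs_fps (\<lambda>n. of_nat (commuting_orbit_count G n))
      = 1 / (1 - fps_const (of_nat q) * fps_X) * (1 + fps_X * Abs_fps c)"
    using assms by (intro fps_linear_recurrence) (auto simp: group.commuting_orbit_count_0)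
  then show ?thesis
    using fps_pow_of_nat[of q 1] by (simp add: commuting_orbit_fps_def)
qed

section \<open>The closed formulas in the two cases\<close>

context maximal_class_group
begin

lemma commuting_orbit_count_eq:
  "of_nat (commuting_orbit_count G n) = (of_nat (card (commuting_tuples G (Suc n))) / of_nat p ^ m :: rat)"
proof -
  have "of_nat p ^ m * of_nat (commuting_orbit_count G n)
      = (of_nat (card (commuting_tuples G (Suc n))) :: rat)"
    using order_mult_commuting_orbit_count[OF finite_carrier, of n] order_eq
    by (metis of_nat_mult of_nat_power)
  then show ?thesis using p_gt_1 by (simp add: field_simps)
qed

lemma commuting_orbit_fps_abelian_maximal:
  assumes "has_abelian_maximal_subgroup G"
  shows "commuting_orbit_fps G =
    1 / (1 - fps_pow p 1 * fps_X) *
    (1 + (fps_pow p (int m - 2) - 1) * fps_X / (1 - fps_pow p (int m - 1) * fps_X)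
       + (fps_pow p 2 - fps_pow p 1) * fps_X / (1 - fps_pow p 2 * fps_X))"
proof -
  \<comment> \<open>Writing \<open>m = k + 4\<close> removes the truncated subtractions from the
    exponents.\<close>
  obtain k where m: "m = k + 4" using four_le_m by (metis le_add_diff_inverse2)
  have exps: "m - 1 = k + 3" by (simp add: m)
  define q :: rat where "q = of_nat p"
  have q: "q \<noteq> 0" using p_gt_1 by (simp add: q_def)
  \<comment> \<open>These inequalities allow the natural-number differences to be cast to rational
    ones.\<close>
  have le: "p \<le> p ^ (k + 3)" "p ^ (k + 3) \<le> p ^ (k + 4)"
    using p_gt_1 power_increasing[of 1 "k + 3" p] power_increasing[of "k + 3" "k + 4" p] by auto
  have card: "of_nat (card (commuting_tuples G (Suc n))) = q * of_nat (card (commuting_tuples G n))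
      + (q ^ (k + 3) - q) * q ^ ((k + 3) * n) + (q ^ (k + 4) - q ^ (k + 3)) * q ^ (2 * n)" for n
    by (simp only: card_commuting_tuples_Suc_abelian_maximal[OF assms, unfolded exps, unfolded m]
        q_def of_nat_add of_nat_mult of_nat_power of_nat_diff le)
  \<comment> \<open>This is the inhomogeneity of the tuple recurrence at \<open>Suc n\<close>,
    divided by the group order \<open>q ^ (k + 4)\<close>.\<close>
  let ?c = "\<lambda>n. (q ^ (k + 2) - 1) * (q ^ (k + 3)) ^ n + (q\<^sup>2 - q) * (q\<^sup>2) ^ n"
  have "of_nat (commuting_orbit_count G (Suc n)) = of_nat p * of_nat (commuting_orbit_count G n) + ?c n" for n
    unfolding commuting_orbit_count_eq card[of "Suc n"] q_def[symmetric] m using q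
    by (simp add: field_simps power_add power_mult power2_eq_square eval_nat_numeral)
  then have "commuting_orbit_fps G = 1 / (1 - fps_pow p 1 * fps_X) * (1 + fps_X * Abs_fps ?c)"
    by (rule commuting_orbit_fps_eq[OF is_group])
  moreover have "Abs_fps ?c = Abs_fps (\<lambda>n. (q ^ (k + 2) - 1) * (q ^ (k + 3)) ^ n)
      + Abs_fps (\<lambda>n. (q\<^sup>2 - q) * (q\<^sup>2) ^ n)"
    by (simp add: fps_eq_iff)
  moreover have "fps_pow p (int m - 2) - 1 = fps_const (q ^ (k + 2) - 1)"
    "fps_pow p (int m - 1) = fps_const (q ^ (k + 3))"
    "fps_pow p 2 - fps_pow p 1 = fps_const (q\<^sup>2 - q)" "fps_pow p 2 = fps_const (q\<^sup>2)"
    using fps_pow_of_nat_diff[of 2 m p] fps_pow_of_nat_diff[of 1 m p]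
      fps_pow_of_nat[of p 1] fps_pow_of_nat[of p 2]
    by (simp_all add: m q_def add.commute[of k 3] flip: fps_const_sub)
  ultimately show ?thesis
    by (simp only: fps_X_divide_geometric ring_distribs add.assoc)
qed

lemma commuting_orbit_fps_two_step:
  assumes "\<not> has_abelian_maximal_subgroup G"
    and "\<And>x y. \<lbrakk>x \<in> two_step_centralizer G 2; y \<in> lower_central G 3\<rbrakk> \<Longrightarrow> commutator G x y = \<one>"
  shows "commuting_orbit_fps G =
    1 / (1 - fps_pow p 1 * fps_X) *
    (1 + (fps_pow p (int m - 4) - 1) * fps_X * (1 - fps_pow p (int m - 4) * fps_X)
           / ((1 - fps_pow p (int m - 2) * fps_X) * (1 - fps_pow p (int m - 3) * fps_X))
       + (fps_pow p (int m - 3) - fps_pow p (int m - 5)) * fps_X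
           / (1 - fps_pow p (int m - 2) * fps_X)
       + (fps_pow p 2 - fps_pow p 1) * fps_X / (1 - fps_pow p 2 * fps_X))"
proof -
  obtain k where m: "m = k + 4" using four_le_m by (metis le_add_diff_inverse2)
  have exps: "m - 1 = k + 3" "m - 2 = k + 2" "m - 3 = k + 1" by (simp_all add: m)
  define q :: rat where "q = of_nat p"
  have q: "q \<noteq> 0" using p_gt_1 by (simp add: q_def)
  have le: "p \<le> p ^ (k + 1)" "p ^ (k + 1) \<le> p ^ (k + 3)" "p ^ (k + 3) \<le> p ^ (k + 4)"
    using p_gt_1 power_increasing[of 1 "k + 1" p] power_increasing[of "k + 1" "k + 3" p]
      power_increasing[of "k + 3" "k + 4" p] by auto
  define d where "d n = (of_nat (card (commuting_tuples_in G (two_step_centralizer G 2) n)) :: rat)" for n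
  have card: "of_nat (card (commuting_tuples G (Suc n))) = q * of_nat (card (commuting_tuples G n))
      + (q ^ (k + 1) - q) * d n + (q ^ (k + 3) - q ^ (k + 1)) * q ^ ((k + 2) * n)
      + (q ^ (k + 4) - q ^ (k + 3)) * q ^ (2 * n)" for n
    by (simp only: card_commuting_tuples_Suc_two_step(1)[OF assms, unfolded exps, unfolded m]
        q_def d_def of_nat_add of_nat_mult of_nat_power of_nat_diff le)
  have d_Suc: "d (Suc n) = q ^ (k + 1) * d n + (q ^ (k + 3) - q ^ (k + 1)) * q ^ ((k + 2) * n)" for n
    by (simp only: card_commuting_tuples_Suc_two_step(2)[OF assms, unfolded exps, unfolded m]
        q_def d_def of_nat_add of_nat_mult of_nat_power of_nat_diff le)
  have d_0: "d 0 = 1" by (simp add: d_def commuting_tuples_in_0)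
  \<comment> \<open>Division by the order \<open>q ^ (k + 3)\<close> of \<open>P\<^sub>1\<close>
    makes \<open>e n\<close> the number of \<open>P\<^sub>1\<close>-classes of commuting
    \<open>n\<close>-tuples in \<open>P\<^sub>1\<close>, by Burnside's lemma, so
    \<open>e 0 = 1\<close>.\<close>
  define e where "e n = d (Suc n) / q ^ (k + 3)" for n
  let ?c1 = "\<lambda>n. (q ^ k - 1) * e n"
  \<comment> \<open>The exponent \<open>int k - 1\<close> is negative when \<open>m = 4\<close>,
    hence the integer power.\<close>
  let ?c2 = "\<lambda>n. (q ^ (k + 1) - q powi (int k - 1)) * (q ^ (k + 2)) ^ n"
  let ?c3 = "\<lambda>n. (q\<^sup>2 - q) * (q\<^sup>2) ^ n"
  have powi: "q powi (int k - 1) = q ^ k / q"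
    using q by (simp add: power_int_diff)
  have "of_nat (commuting_orbit_count G (Suc n))
      = of_nat p * of_nat (commuting_orbit_count G n) + (?c1 n + ?c2 n + ?c3 n)" for n
    unfolding commuting_orbit_count_eq card[of "Suc n"] q_def[symmetric] m e_def powi using q
    by (simp add: field_simps power_add power_mult power2_eq_square eval_nat_numeral)
  then have "commuting_orbit_fps G
      = 1 / (1 - fps_pow p 1 * fps_X) * (1 + fps_X * Abs_fps (\<lambda>n. ?c1 n + ?c2 n + ?c3 n))"
    by (rule commuting_orbit_fps_eq[OF is_group])
  moreover have "Abs_fps (\<lambda>n. ?c1 n + ?c2 n + ?c3 n)
      = fps_const (q ^ k - 1) * Abs_fps e + Abs_fps ?c2 + Abs_fps ?c3"
    by (simp add: fps_eq_iff)
  moreover have "fps_X * (fps_const (q ^ k - 1) * Abs_fps e)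
      = fps_const (q ^ k - 1) * fps_X * (1 - fps_const (q ^ k) * fps_X)
        / ((1 - fps_const (q ^ (k + 2)) * fps_X) * (1 - fps_const (q ^ (k + 1)) * fps_X))"
  proof -
    have "fps_X * Abs_fps e = fps_X * (1 - fps_const (q ^ k) * fps_X)
        / ((1 - fps_const (q ^ (k + 2)) * fps_X) * (1 - fps_const (q ^ (k + 1)) * fps_X))"
    \<comment> \<open>Here \<open>r\<close>, \<open>s\<close>, \<open>t\<close> are
      \<open>q ^ (k + 1)\<close>, \<open>q ^ (k + 2)\<close>, \<open>q ^ k\<close>: dividing by the
      order of \<open>P\<^sub>1\<close> leaves exactly the coefficient \<open>s - t\<close>.\<close>
    proof (rule fps_linear_recurrence_geometric)
      show "e 0 = 1" using q by (simp add: e_def d_Suc d_0)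
      show "e (Suc n) = q ^ (k + 1) * e n + (q ^ (k + 2) - q ^ k) * (q ^ (k + 2)) ^ n" for n
        unfolding e_def d_Suc[of "Suc n"] using q
        by (simp add: field_simps power_add power_mult power2_eq_square eval_nat_numeral)
    qed
    then show ?thesis by (simp add: fps_divide_unit mult_ac)
  qed
  moreover have "fps_pow p (int m - 4) = fps_const (q ^ k)"
    "fps_pow p (int m - 4) - 1 = fps_const (q ^ k - 1)"
    "fps_pow p (int m - 3) = fps_const (q ^ (k + 1))"
    "fps_pow p (int m - 2) = fps_const (q ^ (k + 2))"
    "fps_pow p (int m - 3) - fps_pow p (int m - 5) = fps_const (q ^ (k + 1) - q powi (int k - 1))"
    "fps_pow p 2 - fps_pow p 1 = fps_const (q\<^sup>2 - q)" "fps_pow p 2 = fps_const (q\<^sup>2)"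
    using fps_pow_of_nat_diff[of 4 m p] fps_pow_of_nat_diff[of 3 m p] fps_pow_of_nat_diff[of 2 m p]
      fps_pow_of_nat[of p 1] fps_pow_of_nat[of p 2]
    by (simp_all add: m q_def fps_pow_def flip: fps_const_sub)
  ultimately show ?thesis
    by (simp only: fps_X_divide_geometric ring_distribs add.assoc)
qed

end

theorem theorem4p3:
  fixes G :: "('a, 'b) monoid_scheme" and p m :: nat
  assumes "prime p"
    and "maximal_class G p m"
    and "0 < degree_of_commutativity G m"
  shows "(has_abelian_maximal_subgroup G \<longrightarrow>
            commuting_orbit_fps G =
              1 / (1 - fps_pow p 1 * fps_X) *
              (1 + (fps_pow p (int m - 2) - 1) * fps_X / (1 - fps_pow p (int m - 1) * fps_X)
                 + (fps_pow p 2 - fps_pow p 1) * fps_X / (1 - fps_pow p 2 * fps_X)))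
       \<and> (commutator_subgroup G (P_subgroup G m 1) (P_subgroup G m 3) = {\<one>\<^bsub>G\<^esub>} \<and>
            \<not> has_abelian_maximal_subgroup G \<longrightarrow>
            commuting_orbit_fps G =
              1 / (1 - fps_pow p 1 * fps_X) *
              (1 + (fps_pow p (int m - 4) - 1) * fps_X * (1 - fps_pow p (int m - 4) * fps_X)
                     / ((1 - fps_pow p (int m - 2) * fps_X) * (1 - fps_pow p (int m - 3) * fps_X))
                 + (fps_pow p (int m - 3) - fps_pow p (int m - 5)) * fps_X
                     / (1 - fps_pow p (int m - 2) * fps_X)
                 + (fps_pow p 2 - fps_pow p 1) * fps_X / (1 - fps_pow p 2 * fps_X)))"
proof -
  interpret maximal_class_group G p m
    using assms(1,2) by (rule maximal_class_group_of_maximal_class)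
  have P: "P_subgroup G m 1 = two_step_centralizer G 2" "P_subgroup G m 3 = lower_central G 3"
    using four_le_m by (simp_all add: P_subgroup_def)
  have "commutator G x y = \<one>\<^bsub>G\<^esub>"
    if "commutator_subgroup G (P_subgroup G m 1) (P_subgroup G m 3) = {\<one>\<^bsub>G\<^esub>}"
      "x \<in> two_step_centralizer G 2" "y \<in> lower_central G 3" for x y
    using that commutator_in_commutator_subgroup[of x "P_subgroup G m 1" y "P_subgroup G m 3"]
    unfolding P by blast
  then show ?thesis
    using commuting_orbit_fps_abelian_maximal commuting_orbit_fps_two_step by blast
qed

end
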